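(* Let $X=(X_1,\dots,X_n)$ be a sample from a time series, with forward sums $S_k=\sum_{j=1}^k X_j$ and backward sums $S^*_{n-k}=\sum_{j=k+1}^n X_j$. Assume the null hypothesis $\mathbf{H_0}$: there exist normalizations $\gamma_n\to\infty$ and $A_n$ such that $$\gamma_n^{-1}\big(S_{\lfloor n\tau\rfloor}-\lfloor n\tau\rfloor A_n\big)\longrightarrow_{D[0,1]} Z(\tau),$$ where $\{Z(\tau),\tau\in[0,1]\}$ is a nondegenerate a.s. continuous random process. Put $Z^*(u):=Z(1)-Z(1-u)$, $u\in[0,1]$. Then $$\Big(\gamma_n^{-1}\big(S_{\lfloor n\tau_1\rfloor}-\lfloor n\tau_1\rfloor A_n\big),\ \gamma_n^{-1}\big(S^*_{\lfloor n\tau_2\rfloor}-\lfloor n\tau_2\rfloor A_n\big)\Big)\longrightarrow_{D[0,1]\times D[0,1]}\big(Z(\tau_1),Z^*(\tau_2)\big).$$ Moreover, let $\mathcal T=[\underline\tau,\overline\tau]\subset(0,1)$ and assume that $Q_\tau(Z)>0$ a.s. for any $\tau\in\mathcal T$. Then, as $n\to\infty$, $$W_n(X)\to_{\rm law}\sup_{\tau\in\mathcal T}\frac{Q_{1-\tau}(Z^* )}{Q_\tau(Z)},\qquad I_n(X)\to_{\rm law}\int_{\mathcal T}\frac{Q_{1-\tau}(Z^* )}{Q_\tau(Z)}\,d\tau,\qquad R_n(X)\to_{\rm law}\frac{\inf_{\tau\in\mathcal T}Q_{1-\tau}(Z^* )}{\inf_{\tau\in\mathcal T}Q_\tau(Z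)}.$$
   Context: $D[a,b]$ is the space of real-valued cadlag functions on $[a,b]$; it and the products $D[a_1,b_1]\times D[a_2,b_2]$ are endowed with the uniform topology and the $\sigma$-field generated by the open balls. $\longrightarrow_{D[a,b]}$ and $\longrightarrow_{D[a_1,b_1]\times D[a_2,b_2]}$ denote weak convergence of random elements in these spaces as $n\to\infty$; $\to_{\rm law}$ is convergence in law. A random element $Z$ of $D[a,b]$ is nondegenerate if $P(Z(u)=0\ \forall u\in[a,b])=0$. Statistics: for $1\le k<n$, $$V_k(X):=\frac1{k^2}\sum_{j=1}^k\Big(S_j-\frac jkS_k\Big)^2-\Big(\frac1{k^{3/2}}\sum_{j=1}^k\big(S_j-\frac jkS_k\big)\Big)^2,$$ $$V^*_{n-k}(X):=\frac1{(n-k)^2}\sum_{j=k+1}^n\Big(S^*_{n-j+1}-\frac{n-j+1}{n-k}S^*_{n-k}\Big)^2-\Big(\frac1{(n-k)^{3/2}}\sum_{j=k+1}^n\big(S^*_{n-j+1}-\frac{n-j+1}{n-k}S^*_{n-k}\big)\Big)^2.$$ With $\mathcal L_n(\tau):=V^*_{n-\lfloor n\tau\rfloor}(X)/V_{\lfloor n\tau\rfloor}(X)$, $$W_n(X):=\sup_{\tau\in\mathcal T}\mathcal L_n(\tau),\quad I_n(X):=\int_{\mathcal T}\mathcal L_n(\tau)\,d\tau,\quad R_n(X):=\frac{\inf_{\tau\in\mathcal T}V^*_{n-\lfloor n\tau\rfloor}(X)}{\inf_{\tau\in\mathcal T}V_{\lfloor n\tau\rfloor}(X)}.$$ For a process $Z$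 and $\tau>0$, $$Q_\tau(Z):=\frac1{\tau^2}\Big[\int_0^\tau\big(Z(u)-\frac u\tau Z(\tau)\big)^2du-\frac1\tau\Big(\int_0^\tau\big(Z(u)-\frac u\tau Z(\tau)\big)du\Big)^2\Big].$$ *)

theory Defs
  imports "HOL-Probability.Probability"
begin

section \<open>The space \<open>D[a,b]\<close> and products, with the uniform metric\<close>

definition cadlag_on :: "real \<Rightarrow> real \<Rightarrow> (real \<Rightarrow> real) \<Rightarrow> bool" where
  "cadlag_on a b f \<longleftrightarrow>
     (\<forall>t\<in>{a..<b}. continuous (at_right t) f) \<and>
     (\<forall>t\<in>{a<..b}. \<exists>l. (f \<longlongrightarrow> l) (at_left t))"

text \<open>Functions on \<open>[a,b]\<close> are represented by functions in \<^term>\<open>extensional {a..b}\<close>.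
  The ambient space \<^const>\<open>funspace\<close> of bounded functions with the supremum metric
  imposes no restriction: see \<open>mspace_D_space\<close> below.\<close>

definition D_space :: "real \<Rightarrow> real \<Rightarrow> (real \<Rightarrow> real) metric" where
  "D_space a b = submetric (funspace {a..b} euclidean_metric) {f. cadlag_on a b f}"

definition max_metric :: "'d metric \<Rightarrow> 'e metric \<Rightarrow> ('d \<times> 'e) metric" where
  "max_metric m m' = metric (mspace m \<times> mspace m',
     \<lambda>p q. max (mdist m (fst p) (fst q)) (mdist m' (snd p) (snd q)))"

lemma cadlag_on_bounded:
  assumes "a \<le> b" and f: "cadlag_on a b f"
  shows "bounded (f ` {a..b})"
proof -
  have "bounded (f ` ({a..b} \<inter> {a..b}))"
    using \<open>a \<le> b\<close>
  proof (induction rule: Bolzano[where P = "\<lambda>x y. bounded (f ` ({x..y} \<inter> {a..b}))"])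
    case (trans x y z)
    then have "bounded (f ` ({x..y} \<inter> {a..b}) \<union> f ` ({y..z} \<inter> {a..b}))"
      by simp
    moreover have "f ` ({x..z} \<inter> {a..b}) \<subseteq> f ` ({x..y} \<inter> {a..b}) \<union> f ` ({y..z} \<inter> {a..b})"
      by force
    ultimately show ?case
      using bounded_subset by blast
  next
    case (local t)
    have lim_bd: "\<exists>K. \<forall>\<^sub>F s in F. \<bar>f s\<bar> \<le> K" if "(f \<longlongrightarrow> l) F" for l F
    proof -
      have "\<forall>\<^sub>F s in F. dist (f s) l < 1" using that by (simp add: tendstoD)
      then have "\<forall>\<^sub>F s in F. \<bar>f s\<bar> \<le> \<bar>l\<bar> + 1"
        by eventually_elim (auto simp: dist_real_def)
      then show ?thesis by blast
    qed
    have "\<exists>K r. r > t \<and> (\<forall>s. t < s \<and> s < r \<and> s \<le> b \<longrightarrow> \<bar>f s\<bar> \<le> K)"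
    proof (cases "t < b")
      case True
      then have "(f \<longlongrightarrow> f t) (at_right t)"
        using f local by (auto simp: cadlag_on_def continuous_within)
      then obtain K where "\<forall>\<^sub>F s in at_right t. \<bar>f s\<bar> \<le> K" using lim_bd by blast
      then show ?thesis unfolding eventually_at_right_field by blast
    next
      case False
      then show ?thesis by (intro exI[of _ 0] exI[of _ "t + 1"]) auto
    qed
    then obtain K1 r where r: "r > t" "\<And>s. t < s \<Longrightarrow> s < r \<Longrightarrow> s \<le> b \<Longrightarrow> \<bar>f s\<bar> \<le> K1"
      by blast
    have "\<exists>K q. q < t \<and> (\<forall>s. q < s \<and> s < t \<and> a \<le> s \<longrightarrow> \<bar>f s\<bar> \<le> K)"
    proof (cases "a < t")
      case True
      then have "t \<in> {a<..b}" using local by simp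
      then obtain l where "(f \<longlongrightarrow> l) (at_left t)"
        using f unfolding cadlag_on_def by blast
      then obtain K where "\<forall>\<^sub>F s in at_left t. \<bar>f s\<bar> \<le> K" using lim_bd by blast
      then show ?thesis unfolding eventually_at_left_field by blast
    next
      case False
      then show ?thesis by (intro exI[of _ 0] exI[of _ "t - 1"]) auto
    qed
    then obtain K2 q where q: "q < t" "\<And>s. q < s \<Longrightarrow> s < t \<Longrightarrow> a \<le> s \<Longrightarrow> \<bar>f s\<bar> \<le> K2"
      by blast
    have "bounded (f ` ({x..y} \<inter> {a..b}))"
      if xy: "x \<le> t" "t \<le> y" "y - x < min (r - t) (t - q)" for x y
    proof -
      have "\<bar>f s\<bar> \<le> max (max K1 K2) \<bar>f t\<bar>" if "s \<in> {x..y} \<inter> {a..b}" for s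
        using r(2)[of s] q(2)[of s] that xy
        by (cases s t rule: linorder_cases) auto
      then show ?thesis
        unfolding bounded_iff by (intro exI[of _ "max (max K1 K2) \<bar>f t\<bar>"]) auto
    qed
    then show ?case
      using r(1) q(1) by (intro exI[of _ "min (r - t) (t - q)"]) auto
  qed
  then show ?thesis by simp
qed

lemma mspace_D_space:
  assumes "a \<le> b"
  shows "mspace (D_space a b) = {f \<in> extensional {a..b}. cadlag_on a b f}"
  using cadlag_on_bounded[OF assms] by (auto simp: D_space_def Met_TC.fspace_def)

lemma mdist_D_space:
  assumes "a \<le> b" "f \<in> mspace (D_space a b)" "g \<in> mspace (D_space a b)"
  shows "mdist (D_space a b) f g = (SUP t\<in>{a..b}. \<bar>f t - g t\<bar>)"
  using assms by (auto simp: D_space_def Met_TC.fdist_def dist_real_def)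

lemma Metric_space_max:
  "Metric_space (mspace m \<times> mspace m')
     (\<lambda>p q. max (mdist m (fst p) (fst q)) (mdist m' (snd p) (snd q)))"
proof
  fix p q assume "p \<in> mspace m \<times> mspace m'" "q \<in> mspace m \<times> mspace m'"
  then have *: "mdist m (fst p) (fst q) = 0 \<longleftrightarrow> fst p = fst q"
    "mdist m' (snd p) (snd q) = 0 \<longleftrightarrow> snd p = snd q"
    by auto
  have "0 \<le> mdist m (fst p) (fst q)" "0 \<le> mdist m' (snd p) (snd q)" by auto
  then have "max (mdist m (fst p) (fst q)) (mdist m' (snd p) (snd q)) = 0 \<longleftrightarrow>
      mdist m (fst p) (fst q) = 0 \<and> mdist m' (snd p) (snd q) = 0"
    by linarith
  then show "max (mdist m (fst p) (fst q)) (mdist m' (snd p) (snd q)) = 0 \<longleftrightarrow> p = q"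
    by (simp add: * prod_eq_iff)
next
  fix p q r
  assume "p \<in> mspace m \<times> mspace m'" "q \<in> mspace m \<times> mspace m'" "r \<in> mspace m \<times> mspace m'"
  then have "mdist m (fst p) (fst r) \<le> mdist m (fst p) (fst q) + mdist m (fst q) (fst r)"
    "mdist m' (snd p) (snd r) \<le> mdist m' (snd p) (snd q) + mdist m' (snd q) (snd r)"
    by (auto intro: mdist_triangle)
  then show "max (mdist m (fst p) (fst r)) (mdist m' (snd p) (snd r))
      \<le> max (mdist m (fst p) (fst q)) (mdist m' (snd p) (snd q))
        + max (mdist m (fst q) (fst r)) (mdist m' (snd q) (snd r))"
    by linarith
qed (auto simp: mdist_commute max.coboundedI1)

lemma mspace_max_metric [simp]: "mspace (max_metric m m') = mspace m \<times> mspace m'"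
  and mdist_max_metric [simp]: "mdist (max_metric m m') p q =
    max (mdist m (fst p) (fst q)) (mdist m' (snd p) (snd q))"
  by (simp_all add: max_metric_def Metric_space.mspace_metric Metric_space.mdist_metric
      Metric_space_max)


section \<open>Weak convergence\<close>

definition ball_sigma :: "'d metric \<Rightarrow> 'd measure" where
  "ball_sigma m = sigma (mspace m) {mball_of m x r | x r. True}"

text \<open>Limits are only determined almost surely (the process \<open>Z\<^sup>*\<close> below need not have cadlag
  paths on the null set where \<open>Z\<close> is discontinuous), so a limit \<open>Z\<close> is a map that agrees almost
  surely with a genuine random element \<open>Z'\<close>; the convergence does not depend on the
  choice of \<open>Z'\<close>.\<close>

definition weakly_converges ::
    "'d metric \<Rightarrow> 'p measure \<Rightarrow> (nat \<Rightarrow> 'p \<Rightarrow> 'd) \<Rightarrow> 'q measure \<Rightarrow> ('q \<Rightarrow> 'd) \<Rightarrow> bool" where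
  "weakly_converges m M Y N Z \<longleftrightarrow>
     (\<forall>n. Y n \<in> M \<rightarrow>\<^sub>M ball_sigma m) \<and>
     (\<exists>Z'. Z' \<in> N \<rightarrow>\<^sub>M ball_sigma m \<and> (AE \<omega> in N. Z \<omega> = Z' \<omega>) \<and>
        (\<forall>h::'d \<Rightarrow> real. continuous_map (mtopology_of m) euclidean h \<longrightarrow>
            h \<in> borel_measurable (ball_sigma m) \<longrightarrow> bounded (h ` mspace m) \<longrightarrow>
            (\<lambda>n. \<integral>\<omega>. h (Y n \<omega>) \<partial>M) \<longlonglongrightarrow> (\<integral>\<omega>. h (Z' \<omega>) \<partial>N)))"

definition converges_in_law ::
    "'p measure \<Rightarrow> (nat \<Rightarrow> 'p \<Rightarrow> real) \<Rightarrow> 'q measure \<Rightarrow> ('q \<Rightarrow> real) \<Rightarrow> bool" where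
  "converges_in_law M Y N L \<longleftrightarrow>
     (\<forall>n. Y n \<in> borel_measurable M) \<and>
     (\<exists>L'. L' \<in> borel_measurable N \<and> (AE \<omega> in N. L \<omega> = L' \<omega>) \<and>
        weak_conv_m (\<lambda>n. distr M borel (Y n)) (distr N borel L'))"

definition nondegenerate :: "real \<Rightarrow> real \<Rightarrow> 'q measure \<Rightarrow> ('q \<Rightarrow> real \<Rightarrow> real) \<Rightarrow> bool" where
  "nondegenerate a b N Z \<longleftrightarrow> (AE \<omega> in N. \<not> (\<forall>u\<in>{a..b}. Z \<omega> u = 0))"


section \<open>The statistics\<close>

text \<open>A sample path is \<open>x :: nat \<Rightarrow> real\<close>; the observations are \<open>x 1, \<dots>, x n\<close>.
  \<open>bwd_sum x n m\<close> is \<open>S\<^sup>*\<^sub>m\<close>, the sum of the last \<open>m\<close> of the \<open>n\<close> observations.\<close>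

definition fwd_sum :: "(nat \<Rightarrow> real) \<Rightarrow> nat \<Rightarrow> real" where
  "fwd_sum x k = (\<Sum>j=1..k. x j)"

definition bwd_sum :: "(nat \<Rightarrow> real) \<Rightarrow> nat \<Rightarrow> nat \<Rightarrow> real" where
  "bwd_sum x n m = (\<Sum>j=n-m+1..n. x j)"

definition V_stat :: "(nat \<Rightarrow> real) \<Rightarrow> nat \<Rightarrow> real" where
  "V_stat x k =
     1 / real k ^ 2 * (\<Sum>j=1..k. (fwd_sum x j - real j / real k * fwd_sum x k)\<^sup>2)
     - (1 / real k powr (3/2) * (\<Sum>j=1..k. fwd_sum x j - real j / real k * fwd_sum x k))\<^sup>2"

text \<open>\<open>V_star x n k\<close> is \<open>V\<^sup>*\<close> with lower index \<open>n - k\<close>.\<close>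

definition V_star :: "(nat \<Rightarrow> real) \<Rightarrow> nat \<Rightarrow> nat \<Rightarrow> real" where
  "V_star x n k =
     1 / real (n-k) ^ 2 *
       (\<Sum>j=k+1..n. (bwd_sum x n (n-j+1) - real (n-j+1) / real (n-k) * bwd_sum x n (n-k))\<^sup>2)
     - (1 / real (n-k) powr (3/2) *
       (\<Sum>j=k+1..n. bwd_sum x n (n-j+1) - real (n-j+1) / real (n-k) * bwd_sum x n (n-k)))\<^sup>2"

definition L_stat :: "(nat \<Rightarrow> real) \<Rightarrow> nat \<Rightarrow> real \<Rightarrow> real" where
  "L_stat x n \<tau> = V_star x n (nat \<lfloor>real n * \<tau>\<rfloor>) / V_stat x (nat \<lfloor>real n * \<tau>\<rfloor>)"

definition W_stat :: "real set \<Rightarrow> (nat \<Rightarrow> real) \<Rightarrow> nat \<Rightarrow> real" where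
  "W_stat T x n = (SUP \<tau>\<in>T. L_stat x n \<tau>)"

definition I_stat :: "real set \<Rightarrow> (nat \<Rightarrow> real) \<Rightarrow> nat \<Rightarrow> real" where
  "I_stat T x n = integral T (\<lambda>\<tau>. L_stat x n \<tau>)"

definition R_stat :: "real set \<Rightarrow> (nat \<Rightarrow> real) \<Rightarrow> nat \<Rightarrow> real" where
  "R_stat T x n =
     (INF \<tau>\<in>T. V_star x n (nat \<lfloor>real n * \<tau>\<rfloor>)) / (INF \<tau>\<in>T. V_stat x (nat \<lfloor>real n * \<tau>\<rfloor>))"

definition Q_fun :: "real \<Rightarrow> (real \<Rightarrow> real) \<Rightarrow> real" where
  "Q_fun \<tau> z = 1 / \<tau>\<^sup>2 *
     (integral {0..\<tau>} (\<lambda>u. (z u - u / \<tau> * z \<tau>)\<^sup>2)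
      - 1 / \<tau> * (integral {0..\<tau>} (\<lambda>u. z u - u / \<tau> * z \<tau>))\<^sup>2)"

definition reversed :: "(real \<Rightarrow> real) \<Rightarrow> real \<Rightarrow> real" where
  "reversed z u = z 1 - z (1 - u)"

end

theory Submission
  imports Defs
begin

text \<open>The limit has continuous paths, so it lives on a set that is approximated by countably many
  step functions. For such limits the extended continuous mapping theorem (\<open>G\<^sub>n f\<^sub>n \<rightarrow> G z\<close> whenever
  \<open>f\<^sub>n \<rightarrow> z\<close> uniformly implies \<open>G\<^sub>n(Y\<^sub>n) \<rightarrow> G(Z)\<close> in law) has a direct proof with a partition of unity
  made of distance functions, and it applies in spite of the small \<open>\<sigma>\<close>-field.
  The backward sums and the three statistics are functionals \<open>G\<^sub>n\<close> of the forward path \<open>Y\<^sub>n\<close>: centering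
  by \<open>A\<^sub>n\<close> does not change the bridge \<open>S\<^sub>j - (j/k) S\<^sub>k\<close>, the scale \<open>n / \<gamma>\<^sub>n\<^sup>2\<close> cancels in the quotients,
  and \<open>V\<^sup>*\<close> is \<open>V\<close> of the reversed sample. Their convergence is that of Riemann sums, uniformly in
  \<open>\<tau>\<close> by compactness. The quotients make sense because \<open>Q\<^sub>\<tau>(z) > 0\<close> propagates from the left end
  point of \<open>\<T>\<close> to all of \<open>\<T>\<close>.\<close>

section \<open>Filters and limits\<close>

text \<open>Under the uniform metric D[0,1] is not separable and its Borel field is larger than the
  field of the balls, so neither a limit functional \<open>G\<close> nor its approximations
  \<open>Gn\<close> need be measurable on the space itself. Measurability is therefore asked only of
  composites on the two probability spaces: on \<open>M\<close> it comes from the observations, on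
  \<open>N\<close> from a version of \<open>G\<close> after \<open>Z\<close> built on a measurable
  event of full probability. Reversal is an obstacle of its own: the reflection of a cadlag path is
  left continuous and so leaves D. Paths are reflected only through their grid values, which gives a
  map of D into itself that depends on n; this is one reason for allowing functionals that vary with
  n. The assumption on Q provides a null set for each \<tau>, and an uncountable union of null sets
  may fail to be null. Using it at the left end point alone costs a single null set, which is what
  the propagation of positivity is for.\<close>

lemma eventually_nhdsin_metric:
  assumes "z \<in> mspace m"
  shows "eventually P (nhdsin (mtopology_of m) z) \<longleftrightarrow>
    (\<exists>r>0. \<forall>f\<in>mspace m. mdist m z f < r \<longrightarrow> P f)"
proof -
  interpret Metric_space "mspace m" "mdist m" by (rule Metric_space_mspace_mdist)
  have ball: "\<exists>s>0. mball x s \<subseteq> mball z r" if "x \<in> mball z r" for x r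
    using openin_mball[of z r] that unfolding openin_mtopology by blast
  have "eventually P (nhdsin (mtopology_of m) z) \<longleftrightarrow>
      (\<exists>S. openin mtopology S \<and> z \<in> S \<and> (\<forall>x\<in>S. P x))"
    using assms by (simp add: eventually_nhdsin mtopology_of_def)
  also have "\<dots> \<longleftrightarrow> (\<exists>r>0. \<forall>f\<in>mball z r. P f)"
  proof
    assume "\<exists>S. openin mtopology S \<and> z \<in> S \<and> (\<forall>x\<in>S. P x)"
    then show "\<exists>r>0. \<forall>f\<in>mball z r. P f"
      unfolding openin_mtopology by blast
  next
    assume "\<exists>r>0. \<forall>f\<in>mball z r. P f"
    then obtain r where "r > 0" "\<forall>f\<in>mball z r. P f" by blast
    then show "\<exists>S. openin mtopology S \<and> z \<in> S \<and> (\<forall>x\<in>S. P x)"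
      using assms by (intro exI[of _ "mball z r"]) auto
  qed
  finally have "eventually P (nhdsin (mtopology_of m) z) \<longleftrightarrow> (\<exists>r>0. \<forall>f\<in>mball z r. P f)" .
  then show ?thesis using assms by (auto simp: in_mball)
qed

lemma nhdsin_metric_neq_bot:
  assumes "z \<in> mspace m"
  shows "nhdsin (mtopology_of m) z \<noteq> bot"
proof -
  have "mdist m z z = 0" using assms by simp
  then have "\<exists>f\<in>mspace m. mdist m z f < r" if "r > 0" for r
    using assms that by metis
  then show ?thesis
    unfolding trivial_limit_def eventually_nhdsin_metric[OF assms] by blast
qed

text \<open>The hypothesis on \<open>x\<close> says that the point filter of \<open>x\<close>
  refines \<open>E\<close>, so freezing the second argument at \<open>x\<close> refines the product
  filter.\<close>

lemma tendsto_fixed_snd: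
  assumes lim: "((\<lambda>(i, x). f i x) \<longlongrightarrow> l) (F \<times>\<^sub>F E)" and x: "\<And>P. eventually P E \<Longrightarrow> P x"
  shows "((\<lambda>i. f i x) \<longlongrightarrow> l) F"
proof -
  have "filterlim (\<lambda>i. (i, x)) (F \<times>\<^sub>F E) F"
    unfolding filterlim_iff
  proof (intro allI impI)
    fix R assume "eventually R (F \<times>\<^sub>F E)"
    then obtain P Q where P: "eventually P F" and Q: "eventually Q E"
      and R: "\<And>i x. P i \<Longrightarrow> Q x \<Longrightarrow> R (i, x)"
      unfolding eventually_prod_filter by blast
    show "\<forall>\<^sub>F i in F. R (i, x)" by (intro eventually_mono[OF P] R x[OF Q])
  qed
  from filterlim_compose[OF lim this] show ?thesis by simp
qed

text \<open>An argument of Moore-Osgood type: the joint limit controls all late \<open>i\<close> at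
  once, and \<open>F \<noteq> bot\<close> supplies one late \<open>i\<close> at which
  \<open>f i x\<close> is also close to its own limit \<open>l x\<close>.\<close>

lemma tendsto_limit_of_limits:
  fixes f :: "'i \<Rightarrow> 'x \<Rightarrow> real"
  assumes lim: "((\<lambda>(i, x). f i x) \<longlongrightarrow> l0) (F \<times>\<^sub>F E)"
    and pt: "\<forall>\<^sub>F x in E. ((\<lambda>i. f i x) \<longlongrightarrow> l x) F" and F: "F \<noteq> bot"
  shows "(l \<longlongrightarrow> l0) E"
proof (rule tendstoI)
  fix e :: real assume "e > 0"
  then have "\<forall>\<^sub>F p in F \<times>\<^sub>F E. dist (case p of (i, x) \<Rightarrow> f i x) l0 < e / 2"
    using lim by (intro tendstoD) auto
  then obtain P Q where P: "eventually P F" and Q: "eventually Q E"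
    and PQ: "\<And>i x. P i \<Longrightarrow> Q x \<Longrightarrow> dist (f i x) l0 < e / 2"
    unfolding eventually_prod_filter by auto
  show "\<forall>\<^sub>F x in E. dist (l x) l0 < e"
    using Q pt
  proof eventually_elim
    case (elim x)
    have "\<forall>\<^sub>F i in F. dist (f i x) (l x) < e / 2"
      using elim \<open>e > 0\<close> by (intro tendstoD) auto
    then have "\<exists>i. P i \<and> dist (f i x) (l x) < e / 2"
      using eventually_happens'[OF F eventually_conj[OF P]] by blast
    then obtain i where "dist (f i x) l0 < e / 2" "dist (f i x) (l x) < e / 2"
      using PQ elim by blast
    then show ?case
      using dist_triangle[of "l x" l0 "f i x"] by (simp add: dist_commute)
  qed
qed

lemma continuous_map_tendsto_nhdsin:
  fixes h :: "'d \<Rightarrow> 'e::topological_space"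
  assumes "continuous_map X euclidean h" and p: "p \<in> topspace X"
  shows "(h \<longlongrightarrow> h p) (nhdsin X p)"
proof (rule topological_tendstoI)
  fix S assume "open S" "h p \<in> S"
  then have "openin X {q \<in> topspace X. h q \<in> S}"
    using assms(1) by (auto simp: continuous_map)
  then show "\<forall>\<^sub>F q in nhdsin X p. h q \<in> S"
    using p \<open>h p \<in> S\<close> unfolding eventually_nhdsin by blast
qed

text \<open>Continuity of \<open>G\<close> relative to \<open>C\<close> comes for free: a constant
  sequence at \<open>f\<close> in \<open>C\<close> gives \<open>Gn n f\<close> tending to
  \<open>G f\<close>, and limits of limits agree with the joint limit. Nothing is known about
  \<open>G\<close> off \<open>C\<close>, hence the relative filter.\<close>

lemma continuous_limit_of_joint_limits:
  fixes G :: "'d \<Rightarrow> real"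
  assumes C: "C \<subseteq> mspace m"
    and lim: "\<And>z. z \<in> C \<Longrightarrow>
        ((\<lambda>(n, f). Gn n f) \<longlongrightarrow> G z) (sequentially \<times>\<^sub>F nhdsin (mtopology_of m) z)"
    and z: "z \<in> C"
  shows "(G \<longlongrightarrow> G z) (inf (nhdsin (mtopology_of m) z) (principal C))"
proof (rule tendsto_limit_of_limits)
  show "((\<lambda>(n, f). Gn n f) \<longlongrightarrow> G z)
      (sequentially \<times>\<^sub>F inf (nhdsin (mtopology_of m) z) (principal C))"
    by (rule tendsto_mono[OF prod_filter_mono lim[OF z]]) auto
  have "((\<lambda>n. Gn n f) \<longlongrightarrow> G f) sequentially" if f: "f \<in> C" for f
    using lim[OF f]
  proof (rule tendsto_fixed_snd)
    show "P f" if "eventually P (nhdsin (mtopology_of m) f)" for P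
      using that f C unfolding eventually_nhdsin by auto
  qed
  then show "\<forall>\<^sub>F f in inf (nhdsin (mtopology_of m) z) (principal C). (\<lambda>n. Gn n f) \<longlonglongrightarrow> G f"
    unfolding eventually_inf_principal by (intro always_eventually) blast
qed simp

section \<open>Weak convergence to a limit with separable range\<close>

lemma space_ball_sigma [simp]: "space (ball_sigma m) = mspace m"
  unfolding ball_sigma_def by (rule space_measure_of) auto

lemma sets_ball_sigma: "sets (ball_sigma m) = sigma_sets (mspace m) {mball_of m x r |x r. True}"
  unfolding ball_sigma_def by (rule sets_measure_of) auto

lemma mball_of_in_ball_sigma: "mball_of m x r \<in> sets (ball_sigma m)"
  unfolding sets_ball_sigma by auto

lemma measurable_ball_sigmaI:
  assumes "\<And>\<omega>. \<omega> \<in> space N \<Longrightarrow> Y \<omega> \<in> mspace m"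
    and "\<And>x r. x \<in> mspace m \<Longrightarrow> {\<omega> \<in> space N. mdist m x (Y \<omega>) < r} \<in> sets N"
  shows "Y \<in> N \<rightarrow>\<^sub>M ball_sigma m"
  unfolding ball_sigma_def
proof (rule measurable_measure_of)
  fix B assume "B \<in> {mball_of m x r |x r. True}"
  then obtain x r where B: "B = mball_of m x r" by auto
  show "Y -` B \<inter> space N \<in> sets N"
  proof (cases "x \<in> mspace m")
    case True
    then have "Y -` B \<inter> space N = {\<omega> \<in> space N. mdist m x (Y \<omega>) < r}"
      using assms(1) by (auto simp: B)
    then show ?thesis using assms(2) True by simp
  next
    case False
    then have "Y -` B \<inter> space N = {}" by (auto simp: B)
    then show ?thesis by simp
  qed
qed (use assms in auto)

lemma borel_measurable_mdist_ball_sigma: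
  assumes "x \<in> mspace m"
  shows "mdist m x \<in> borel_measurable (ball_sigma m)"
proof (rule borel_measurableI_less)
  fix y
  have "{w \<in> space (ball_sigma m). mdist m x w < y} = mball_of m x y"
    using assms by auto
  then show "{w \<in> space (ball_sigma m). mdist m x w < y} \<in> sets (ball_sigma m)"
    by (simp add: mball_of_in_ball_sigma)
qed

text \<open>\<open>N\<close> need not be complete, so an almost sure property need not define a
  measurable set. Definitions by cases on such a property use the measurable event obtained
  here.\<close>

lemma AE_subset_setsE:
  assumes "AE \<omega> in N. P \<omega>"
  obtains \<Omega> where "\<Omega> \<in> sets N" "\<And>\<omega>. \<omega> \<in> \<Omega> \<Longrightarrow> P \<omega>" "AE \<omega> in N. \<omega> \<in> \<Omega>"
proof -
  obtain B where B: "{\<omega> \<in> space N. \<not> P \<omega>} \<subseteq> B" "emeasure N B = 0" "B \<in> sets N"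
    using assms by (auto elim: AE_E)
  show ?thesis
  proof (rule that[of "space N - B"])
    show "AE \<omega> in N. \<omega> \<in> space N - B"
      using B by (intro AE_I[of _ _ B]) auto
  qed (use B in auto)
qed

text \<open>The \<open>\<sigma>\<close>-field of the balls need not contain the open sets, but on a subset \<open>C\<close> that is
  approximated by a countable set \<open>Q\<close>, open sets are traces of countable unions of balls.\<close>

lemma measurable_version:
  fixes G :: "'d \<Rightarrow> real"
  assumes Q: "countable Q" "Q \<subseteq> mspace m" and C: "C \<subseteq> mspace m"
    and dense: "\<And>z e. z \<in> C \<Longrightarrow> e > 0 \<Longrightarrow> \<exists>q\<in>Q. mdist m z q < e"
    and cont: "\<And>z. z \<in> C \<Longrightarrow> (G \<longlongrightarrow> G z) (inf (nhdsin (mtopology_of m) z) (principal C))"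
    and Z: "Z \<in> N \<rightarrow>\<^sub>M ball_sigma m" and "\<Omega> \<in> sets N" "\<And>\<omega>. \<omega> \<in> \<Omega> \<Longrightarrow> Z \<omega> \<in> C"
  shows "(\<lambda>\<omega>. if \<omega> \<in> \<Omega> then G (Z \<omega>) else 0) \<in> borel_measurable N"
proof (rule borel_measurableI_greater)
  fix a
  define I where "I = {(q, s) \<in> Q \<times> \<rat>. \<forall>z\<in>C \<inter> mball_of m q s. G z > a}"
  define U where "U = (\<Union>(q, s)\<in>I. mball_of m q s)"
  have "countable I"
    unfolding I_def using Q(1) countable_rat by (auto intro: countable_subset[of _ "Q \<times> \<rat>"])
  then have U: "U \<in> sets (ball_sigma m)"
    unfolding U_def by (auto intro!: sets.countable_UN' mball_of_in_ball_sigma)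
  have *: "z \<in> U \<longleftrightarrow> G z > a" if z: "z \<in> C" for z
  proof
    assume "z \<in> U" then show "G z > a" using z by (auto simp: U_def I_def)
  next
    assume "G z > a"
    then have "\<forall>\<^sub>F f in inf (nhdsin (mtopology_of m) z) (principal C). G f > a"
      using cont[OF z] by (rule order_tendstoD(1)[rotated])
    then obtain r where r: "r > 0" "\<And>f. f \<in> C \<Longrightarrow> mdist m z f < r \<Longrightarrow> G f > a"
      using z C by (subst (asm) eventually_inf_principal, subst (asm) eventually_nhdsin_metric) auto
    \<comment> \<open>Half of \<open>r\<close>: a point within \<open>s\<close> of \<open>q\<close>
      is within \<open>2 * s\<close> of \<open>z\<close> once \<open>q\<close> is within
      \<open>s\<close> of \<open>z\<close>.\<close>
    obtain s where s: "s \<in> \<rat>" "0 < s" "s < r / 2"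
      using Rats_dense_in_real[of 0 "r / 2"] r by auto
    obtain q where q: "q \<in> Q" "mdist m z q < s" using dense[OF z, of s] s by auto
    have "(q, s) \<in> I"
      unfolding I_def using q s Q(2) z C
      by (auto intro!: r(2) simp: mdist_commute intro: order.strict_trans1[OF mdist_triangle[of z m q]])
    moreover have "z \<in> mball_of m q s" using q Q z C by (auto simp: mdist_commute)
    ultimately show "z \<in> U" unfolding U_def by blast
  qed
  have eq: "{\<omega> \<in> space N. (if \<omega> \<in> \<Omega> then G (Z \<omega>) else 0) > a} =
      \<Omega> \<inter> (Z -` U \<inter> space N) \<union> (if 0 > a then space N - \<Omega> else {})"
    using * assms(7,8) sets.sets_into_space by auto
  show "{\<omega> \<in> space N. (if \<omega> \<in> \<Omega> then G (Z \<omega>) else 0) > a} \<in> sets N"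
    unfolding eq using measurable_sets[OF Z U] assms(7) by auto
qed

text \<open>\<open>Q\<close> need not lie in \<open>C\<close>: continuous paths will be approximated
  by step functions. \<open>C\<close> is a parameter because joint convergence uses all continuous
  paths, while the statistics have limits only on a smaller set. \<open>Z\<close> is a genuine
  random element here, not merely almost surely equal to one.\<close>

locale separable_weak_limit = M: prob_space M + N: prob_space N
  for M :: "'p measure" and N :: "'q measure" +
  fixes m :: "'d metric" and Y :: "nat \<Rightarrow> 'p \<Rightarrow> 'd" and Z :: "'q \<Rightarrow> 'd" and Q C :: "'d set"
  assumes Q: "countable Q" "Q \<subseteq> mspace m" and C: "C \<subseteq> mspace m"
    and dense: "\<And>z e. z \<in> C \<Longrightarrow> e > 0 \<Longrightarrow> \<exists>q\<in>Q. mdist m z q < e"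
    and Y: "\<And>n. Y n \<in> M \<rightarrow>\<^sub>M ball_sigma m"
    and Z: "Z \<in> N \<rightarrow>\<^sub>M ball_sigma m" "AE \<omega> in N. Z \<omega> \<in> C"
    and weak: "\<And>h :: 'd \<Rightarrow> real. continuous_map (mtopology_of m) euclidean h \<Longrightarrow>
        h \<in> borel_measurable (ball_sigma m) \<Longrightarrow> bounded (h ` mspace m) \<Longrightarrow>
        (\<lambda>n. \<integral>\<omega>. h (Y n \<omega>) \<partial>M) \<longlonglongrightarrow> (\<integral>\<omega>. h (Z \<omega>) \<partial>N)"
begin

text \<open>Convergence along \<open>sequentially \<times>\<^sub>F nhdsin (mtopology_of m) z\<close> says that
  \<open>G\<^sub>n f\<^sub>n \<rightarrow> G z\<close> whenever \<open>f\<^sub>n \<rightarrow> z\<close>. The proof replaces both \<open>G\<^sub>n\<close> and \<open>G\<close> by one continuous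
  function of finitely many distances \<open>d(q, \<cdot>)\<close>, which is measurable for the \<open>\<sigma>\<close>-field of the balls.\<close>

lemma expectation_tendsto:
  fixes G :: "'d \<Rightarrow> real" and Gn :: "nat \<Rightarrow> 'd \<Rightarrow> real"
  assumes lim: "\<And>z. z \<in> C \<Longrightarrow>
        ((\<lambda>(n, f). Gn n f) \<longlongrightarrow> G z) (sequentially \<times>\<^sub>F nhdsin (mtopology_of m) z)"
    and H: "\<And>n. H n \<in> borel_measurable M" "\<forall>\<^sub>F n in sequentially. \<forall>\<omega>\<in>space M. H n \<omega> = Gn n (Y n \<omega>)"
    and L: "L \<in> borel_measurable N" "AE \<omega> in N. G (Z \<omega>) = L \<omega>"
    and bdd: "\<And>n f. f \<in> mspace m \<Longrightarrow> \<bar>Gn n f\<bar> \<le> B" "\<And>f. f \<in> C \<Longrightarrow> \<bar>G f\<bar> \<le> B"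
  shows "(\<lambda>n. \<integral>\<omega>. H n \<omega> \<partial>M) \<longlonglongrightarrow> (\<integral>\<omega>. L \<omega> \<partial>N)"
proof -
  have cont: "(G \<longlongrightarrow> G z) (inf (nhdsin (mtopology_of m) z) (principal C))" if "z \<in> C" for z
    by (rule continuous_limit_of_joint_limits[OF C lim that])
  have "\<exists>f. f \<in> mspace m"
    using measurable_space[OF Z(1)] N.not_empty by auto
  then have B: "B \<ge> 0" using bdd(1) by force
  \<comment> \<open>The errors are \<open>e + 4 * B * e\<close> on the side of \<open>H\<close>,
    \<open>e\<close> between the two expectations of \<open>\<psi>\<close>, and
    \<open>e + 2 * B * e\<close> on the side of \<open>L\<close>; \<open>3 + 8 * B\<close> bounds
    their sum.\<close>
  have approx: "\<forall>\<^sub>F n in sequentially. \<bar>(\<integral>\<omega>. H n \<omega> \<partial>M) - (\<integral>\<omega>. L \<omega> \<partial>N)\<bar> \<le> (3 + 8 * B) * e" if e: "e > 0" for e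
  proof -
    \<comment> \<open>The same constant \<open>c\<close> serves \<open>G\<close> and all late
      \<open>Gn\<close>; this is what allows one test function to replace both.\<close>
    define good where "good q s n0 \<longleftrightarrow> (\<exists>c. \<bar>c\<bar> \<le> B \<and> (\<forall>f\<in>mball_of m q s.
        (\<forall>n\<ge>n0. \<bar>Gn n f - c\<bar> \<le> e) \<and> (f \<in> C \<longrightarrow> \<bar>G f - c\<bar> \<le> e)))" for q s n0
    define I where "I = {(q, s, n0). q \<in> Q \<and> s \<in> \<rat> \<and> s > 0 \<and> good q s n0}"
    have cI: "countable I"
      unfolding I_def using Q(1) countable_rat
      by (auto intro: countable_subset[of _ "Q \<times> \<rat> \<times> UNIV"])
    \<comment> \<open>Half the radius: on the half ball the bump function \<open>\<phi>\<close>
      below is at least 1, while it vanishes only off the full ball, where the constant is no longer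
      valid.\<close>
    define U where "U i = mball_of m (fst i) (fst (snd i) / 2)" for i :: "'d \<times> real \<times> nat"
    have U: "U i \<in> sets (ball_sigma m)" for i unfolding U_def by (rule mball_of_in_ball_sigma)
    have cover: "\<exists>i\<in>I. z \<in> U i" if z: "z \<in> C" for z
    proof -
      have zm: "z \<in> mspace m" using z C by auto
      have "\<forall>\<^sub>F p in sequentially \<times>\<^sub>F nhdsin (mtopology_of m) z. dist (case p of (n, f) \<Rightarrow> Gn n f) (G z) < e"
        using lim[OF z] e by (intro tendstoD) auto
      then obtain P P' where P: "eventually P sequentially"
          and P': "eventually P' (nhdsin (mtopology_of m) z)"
          and PP: "\<And>n f. P n \<Longrightarrow> P' f \<Longrightarrow> \<bar>Gn n f - G z\<bar> < e"
        unfolding eventually_prod_filter dist_real_def by auto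
      obtain n0 where n0: "\<And>n. n \<ge> n0 \<Longrightarrow> P n" using P by (auto simp: eventually_sequentially)
      obtain r1 where r1: "r1 > 0" "\<And>f. f \<in> mspace m \<Longrightarrow> mdist m z f < r1 \<Longrightarrow> P' f"
        using P' by (auto simp: eventually_nhdsin_metric[OF zm])
      have "\<forall>\<^sub>F f in inf (nhdsin (mtopology_of m) z) (principal C). dist (G f) (G z) < e"
        using cont[OF z] e by (intro tendstoD) auto
      then obtain r2 where r2: "r2 > 0" "\<And>f. f \<in> C \<Longrightarrow> mdist m z f < r2 \<Longrightarrow> \<bar>G f - G z\<bar> < e"
        using C unfolding eventually_inf_principal eventually_nhdsin_metric[OF zm] dist_real_def by auto
      obtain s where s: "s \<in> \<rat>" "0 < s" "s < min r1 r2 / 2"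
        using Rats_dense_in_real[of 0 "min r1 r2 / 2"] r1 r2 by auto
      \<comment> \<open>Distance below \<open>s / 2\<close> puts \<open>z\<close> into the half
        ball, and the full ball of radius \<open>s\<close> stays within \<open>3 * s / 2\<close> of
        \<open>z\<close>.\<close>
      obtain q where q: "q \<in> Q" "mdist m z q < s / 2" using dense[OF z, of "s / 2"] s by auto
      have near: "mdist m z f < min r1 r2" if "f \<in> mball_of m q s" for f
        using mdist_triangle[of z m q f] that q Q(2) zm s by auto
      have "good q s n0"
        unfolding good_def
      proof (intro exI[of _ "G z"] conjI ballI allI impI)
        show "\<bar>G z\<bar> \<le> B" using bdd(2) z by auto
      next
        fix f n assume "f \<in> mball_of m q s" "n \<ge> n0"
        then show "\<bar>Gn n f - G z\<bar> \<le> e"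
          using near[of f] PP[OF n0, of n f] r1(2)[of f] by auto
      next
        fix f assume "f \<in> mball_of m q s" "f \<in> C"
        then show "\<bar>G f - G z\<bar> \<le> e" using near[of f] r2(2)[of f] by auto
      qed
      then have "(q, s, n0) \<in> I" using q s by (auto simp: I_def)
      moreover have "z \<in> U (q, s, n0)" using q Q(2) zm by (auto simp: U_def mdist_commute)
      ultimately show ?thesis by blast
    qed
    \<comment> \<open>Countably many half balls cover \<open>C\<close>, which carries the law of
      \<open>Z\<close>, so by continuity from below finitely many carry mass above
      \<open>1 - e\<close>. This takes the place of tightness.\<close>
    have "\<exists>J\<subseteq>I. finite J \<and> measure N (Z -` (\<Union>i\<in>J. U i) \<inter> space N) > 1 - e"
    proof (cases "I = {}")
      case True
      then have "C = {}" using cover by auto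
      then have "AE \<omega> in N. False" using Z(2) by simp
      then have False using N.AE_False by simp
      then show ?thesis ..
    next
      case False
      define A where "A k = Z -` (\<Union>j\<le>k. U (from_nat_into I j)) \<inter> space N" for k :: nat
      have A: "A k \<in> sets N" for k
        unfolding A_def using U by (intro measurable_sets[OF Z(1)]) auto
      have "(\<lambda>k. measure N (A k)) \<longlonglongrightarrow> measure N (\<Union>k. A k)"
        using A by (intro N.finite_Lim_measure_incseq) (auto simp: incseq_def A_def intro: order_trans)
      moreover have "measure N (\<Union>k. A k) = 1"
      proof (rule N.prob_eq_1[THEN iffD2])
        show "AE \<omega> in N. \<omega> \<in> (\<Union>k. A k)"
          using Z(2) AE_space
        proof eventually_elim
          case (elim \<omega>)
          then obtain i where "i \<in> I" "Z \<omega> \<in> U i" using cover by blast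
          moreover obtain k where "i = from_nat_into I k"
            using from_nat_into_surj[OF cI \<open>i \<in> I\<close>] by auto
          ultimately show ?case using elim by (auto simp: A_def)
        qed
      qed (use A in auto)
      ultimately have "\<forall>\<^sub>F k in sequentially. measure N (A k) > 1 - e"
        using e by (intro order_tendstoD(1)) auto
      then obtain k where "measure N (A k) > 1 - e" by (auto simp: eventually_sequentially)
      then show ?thesis
        using from_nat_into[OF False]
        by (intro exI[of _ "from_nat_into I ` {..k}"]) (auto simp: A_def)
    qed
    then obtain J where J: "J \<subseteq> I" "finite J"
      and JU: "measure N (Z -` (\<Union>i\<in>J. U i) \<inter> space N) > 1 - e" by blast
    have "\<forall>i\<in>J. \<exists>c. \<bar>c\<bar> \<le> B \<and> (\<forall>f\<in>mball_of m (fst i) (fst (snd i)).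
        (\<forall>n\<ge>snd (snd i). \<bar>Gn n f - c\<bar> \<le> e) \<and> (f \<in> C \<longrightarrow> \<bar>G f - c\<bar> \<le> e))"
      using J(1) unfolding I_def good_def by auto
    then obtain c where c: "\<And>i. i \<in> J \<Longrightarrow> \<bar>c i\<bar> \<le> B"
      and cn: "\<And>i f n. i \<in> J \<Longrightarrow> f \<in> mball_of m (fst i) (fst (snd i)) \<Longrightarrow> n \<ge> snd (snd i) \<Longrightarrow> \<bar>Gn n f - c i\<bar> \<le> e"
      and cC: "\<And>i f. i \<in> J \<Longrightarrow> f \<in> mball_of m (fst i) (fst (snd i)) \<Longrightarrow> f \<in> C \<Longrightarrow> \<bar>G f - c i\<bar> \<le> e"
      by (subst (asm) bchoice_iff) blast
    have pos: "fst (snd i) > 0" and qm: "fst i \<in> mspace m" if "i \<in> J" for i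
      using subsetD[OF J(1) that] Q(2) by (auto simp: I_def split: prod.splits)
    define \<phi> where "\<phi> i f = max 0 (2 - 2 * mdist m (fst i) f / fst (snd i))"
      for i :: "'d \<times> real \<times> nat" and f
    define S where "S f = (\<Sum>i\<in>J. \<phi> i f)" for f
    \<comment> \<open>Where \<open>S f\<close> is at least 1/2 this is the average of the constants
      \<open>c i\<close> with weights \<open>\<phi> i f\<close>. The floor 1/2 in the denominator
      keeps the quotient continuous and bounded by \<open>B\<close> on the whole space.\<close>
    define \<psi> where "\<psi> f = (\<Sum>i\<in>J. c i * \<phi> i f) / max (1/2) (S f)" for f
    \<comment> \<open>\<open>k\<close> marks the region where \<open>\<psi>\<close> is not reliable:
      it is 1 for \<open>S f \<le> 1/2\<close> and 0 for \<open>S f \<ge> 1\<close>, in particular 0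
      on the chosen half balls.\<close>
    define k where "k f = max 0 (min 1 (2 - 2 * S f))" for f
    have \<phi>0: "\<phi> i f \<ge> 0" for i f by (simp add: \<phi>_def)
    have S0: "S f \<ge> 0" for f unfolding S_def using \<phi>0 by (intro sum_nonneg) auto
    have k01: "0 \<le> k f" "k f \<le> 1" for f by (auto simp: k_def)
    have \<phi>meas: "\<phi> i \<in> borel_measurable (ball_sigma m)"
      and \<phi>cont: "continuous_map (mtopology_of m) euclidean (\<phi> i)" if "i \<in> J" for i
    proof -
      have [measurable]: "mdist m (fst i) \<in> borel_measurable (ball_sigma m)"
        by (rule borel_measurable_mdist_ball_sigma[OF qm[OF that]])
      show "\<phi> i \<in> borel_measurable (ball_sigma m)" unfolding \<phi>_def by measurable
      have "continuous_map (mtopology_of m) euclidean (mdist m (fst i))"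
        using qm[OF that] by (intro continuous_map_mdist) auto
      then show "continuous_map (mtopology_of m) euclidean (\<phi> i)"
        unfolding \<phi>_def using pos[OF that] qm[OF that]
        by (intro continuous_intros) auto
    qed
    have [measurable]: "S \<in> borel_measurable (ball_sigma m)"
      unfolding S_def using \<phi>meas by (intro borel_measurable_sum) auto
    have contS: "continuous_map (mtopology_of m) euclidean S"
      unfolding S_def using \<phi>cont J(2) by (intro continuous_map_sum) auto
    have \<psi>meas[measurable]: "\<psi> \<in> borel_measurable (ball_sigma m)"
      unfolding \<psi>_def using \<phi>meas
      by (intro borel_measurable_divide borel_measurable_sum borel_measurable_times) auto
    have kmeas[measurable]: "k \<in> borel_measurable (ball_sigma m)"
      unfolding k_def by measurable
    have contk: "continuous_map (mtopology_of m) euclidean k"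
      unfolding k_def by (intro continuous_intros contS) auto
    have contchi: "continuous_map (mtopology_of m) euclidean \<psi>"
      unfolding \<psi>_def using J(2) by (intro continuous_intros contS \<phi>cont) auto
    have \<psi>B: "\<bar>\<psi> f\<bar> \<le> B" for f
    proof -
      have "\<bar>\<Sum>i\<in>J. c i * \<phi> i f\<bar> \<le> (\<Sum>i\<in>J. B * \<phi> i f)"
        using c \<phi>0 by (intro order_trans[OF sum_abs] sum_mono) (auto simp: abs_mult intro: mult_right_mono)
      also have "\<dots> = B * S f" by (simp add: S_def sum_distrib_left)
      also have "\<dots> \<le> B * max (1/2) (S f)" using B by (intro mult_left_mono) auto
      finally show ?thesis by (simp add: \<psi>_def abs_divide divide_le_eq)
    qed
    \<comment> \<open>Used with \<open>x\<close> a value of \<open>H n\<close> and with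
      \<open>x\<close> a value of \<open>L\<close>. If \<open>S f\<close> is small, then
      \<open>k f = 1\<close> and the trivial bound \<open>2 * B\<close> on the difference
      suffices.\<close>
    have key: "\<bar>x - \<psi> f\<bar> \<le> e + 2 * B * k f"
      if x: "\<bar>x\<bar> \<le> B" and f: "f \<in> mspace m"
        and near: "\<And>i. i \<in> J \<Longrightarrow> f \<in> mball_of m (fst i) (fst (snd i)) \<Longrightarrow> \<bar>x - c i\<bar> \<le> e" for x f
    proof (cases "S f \<ge> 1/2")
      case True
      have "x * S f - (\<Sum>i\<in>J. c i * \<phi> i f) = (\<Sum>i\<in>J. (x - c i) * \<phi> i f)"
        by (simp add: S_def sum_distrib_left sum_subtractf left_diff_distrib)
      also have "\<bar>\<dots>\<bar> \<le> (\<Sum>i\<in>J. e * \<phi> i f)"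
      proof (rule order_trans[OF sum_abs sum_mono])
        fix i assume i: "i \<in> J"
        show "\<bar>(x - c i) * \<phi> i f\<bar> \<le> e * \<phi> i f"
        proof (cases "f \<in> mball_of m (fst i) (fst (snd i))")
          case True
          then show ?thesis using near[OF i] \<phi>0[of i f] by (auto simp: abs_mult intro: mult_right_mono)
        next
          case False
          then have "mdist m (fst i) f \<ge> fst (snd i)" using f qm[OF i] by auto
          then have "\<phi> i f = 0" using pos[OF i] by (auto simp: \<phi>_def max_def field_simps)
          then show ?thesis by simp
        qed
      qed
      also have "\<dots> = e * S f" by (simp add: S_def sum_distrib_left)
      finally have "\<bar>x * S f - (\<Sum>i\<in>J. c i * \<phi> i f)\<bar> \<le> e * S f" .
      moreover have "x - \<psi> f = (x * S f - (\<Sum>i\<in>J. c i * \<phi> i f)) / S f"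
        using True by (simp add: \<psi>_def diff_divide_distrib max_def)
      ultimately have "\<bar>x - \<psi> f\<bar> \<le> e" using True by (simp add: abs_divide divide_le_eq)
      then show ?thesis using B k01(1)[of f] by (smt (verit) mult_nonneg_nonneg)
    next
      case False
      then have "k f = 1" by (simp add: k_def)
      then show ?thesis using x \<psi>B[of f] e by auto
    qed
    have Zk: "(\<integral>\<omega>. k (Z \<omega>) \<partial>N) \<le> e"
    proof -
      let ?A = "Z -` (\<Union>i\<in>J. U i) \<inter> space N"
      have A[measurable]: "?A \<in> sets N" using U J(2) by (intro measurable_sets[OF Z(1)]) auto
      have "(\<integral>\<omega>. k (Z \<omega>) \<partial>N) \<le> (\<integral>\<omega>. indicator (space N - ?A) \<omega> \<partial>N)"
      proof (rule integral_mono_AE)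
        show "integrable N (\<lambda>\<omega>. k (Z \<omega>))"
          using Z(1) k01 by (intro N.integrable_const_bound[of _ 1]) auto
        show "AE \<omega> in N. k (Z \<omega>) \<le> indicator (space N - ?A) \<omega>"
        proof (rule AE_I2)
          fix \<omega> assume \<omega>: "\<omega> \<in> space N"
          show "k (Z \<omega>) \<le> indicator (space N - ?A) \<omega>"
          proof (cases "\<omega> \<in> ?A")
            case True
            then obtain i where i: "i \<in> J" "Z \<omega> \<in> U i" by auto
            then have "\<phi> i (Z \<omega>) \<ge> 1" using pos[OF i(1)] by (auto simp: U_def \<phi>_def field_simps max_def)
            moreover have "\<phi> i (Z \<omega>) \<le> S (Z \<omega>)"
              unfolding S_def using i J(2) \<phi>0 by (intro member_le_sum) auto
            ultimately have "k (Z \<omega>) = 0" by (simp add: k_def)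
            then show ?thesis by simp
          qed (use \<omega> k01 in auto)
        qed
      qed (auto intro: N.integrable_const_bound[of _ 1])
      also have "\<dots> = measure N (space N - ?A)" by simp
      also have "\<dots> = 1 - measure N ?A" using A N.prob_compl by blast
      finally show ?thesis using JU by simp
    qed
    have \<psi>bd: "bounded (\<psi> ` mspace m)" using \<psi>B by (auto simp: bounded_iff)
    have kbd: "bounded (k ` mspace m)" using k01 by (auto simp: bounded_iff intro!: exI[of _ 1])
    \<comment> \<open>As \<open>k\<close> is itself an admissible test function, the small mass of
      \<open>Z\<close> outside the half balls is inherited by \<open>Y n\<close> for large
      \<open>n\<close>.\<close>
    have "(\<lambda>n. \<integral>\<omega>. k (Y n \<omega>) \<partial>M) \<longlonglongrightarrow> (\<integral>\<omega>. k (Z \<omega>) \<partial>N)"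
      by (rule weak[OF contk kmeas kbd])
    then have ev1: "\<forall>\<^sub>F n in sequentially. (\<integral>\<omega>. k (Y n \<omega>) \<partial>M) < 2 * e"
      using Zk e by (intro order_tendstoD(2)) auto
    have "(\<lambda>n. \<integral>\<omega>. \<psi> (Y n \<omega>) \<partial>M) \<longlonglongrightarrow> (\<integral>\<omega>. \<psi> (Z \<omega>) \<partial>N)"
      by (rule weak[OF contchi \<psi>meas \<psi>bd])
    then have ev2: "\<forall>\<^sub>F n in sequentially. dist (\<integral>\<omega>. \<psi> (Y n \<omega>) \<partial>M) (\<integral>\<omega>. \<psi> (Z \<omega>) \<partial>N) < e"
      using e by (rule tendstoD)
    have ev3: "\<forall>\<^sub>F n in sequentially. \<forall>i\<in>J. n \<ge> snd (snd i)"
      using J(2) by (auto simp: eventually_ball_finite_distrib intro: eventually_ge_at_top)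
    have L\<psi>: "\<bar>(\<integral>\<omega>. L \<omega> \<partial>N) - (\<integral>\<omega>. \<psi> (Z \<omega>) \<partial>N)\<bar> \<le> e + 2 * B * e"
    proof -
      have bdL: "AE \<omega> in N. \<bar>L \<omega>\<bar> \<le> B" using L(2) Z(2)
        by eventually_elim (use bdd(2) in force)
      have iL: "integrable N L" using L bdL by (intro N.integrable_const_bound[of _ B]) auto
      have i\<psi>: "integrable N (\<lambda>\<omega>. \<psi> (Z \<omega>))"
        using Z(1) \<psi>B by (intro N.integrable_const_bound[of _ B]) auto
      have ik: "integrable N (\<lambda>\<omega>. k (Z \<omega>))"
        using Z(1) k01 by (intro N.integrable_const_bound[of _ 1]) auto
      have "\<bar>(\<integral>\<omega>. L \<omega> \<partial>N) - (\<integral>\<omega>. \<psi> (Z \<omega>) \<partial>N)\<bar> = \<bar>\<integral>\<omega>. L \<omega> - \<psi> (Z \<omega>) \<partial>N\<bar>"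
        using iL i\<psi> by simp
      also have "\<dots> \<le> (\<integral>\<omega>. \<bar>L \<omega> - \<psi> (Z \<omega>)\<bar> \<partial>N)" by (rule integral_abs_bound)
      also have "\<dots> \<le> (\<integral>\<omega>. e + 2 * B * k (Z \<omega>) \<partial>N)"
      proof (rule integral_mono_AE)
        show "AE \<omega> in N. \<bar>L \<omega> - \<psi> (Z \<omega>)\<bar> \<le> e + 2 * B * k (Z \<omega>)"
          using L(2) Z(2) bdL AE_space
        proof eventually_elim
          case (elim \<omega>)
          show ?case
          proof (rule key)
            show "\<bar>L \<omega> - c i\<bar> \<le> e" if "i \<in> J" "Z \<omega> \<in> mball_of m (fst i) (fst (snd i))" for i
              using cC[OF that elim(2)] elim(1) by simp
          qed (use elim C in auto)
        qed
      qed (use iL i\<psi> ik in auto)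
      also have "\<dots> = e + 2 * B * (\<integral>\<omega>. k (Z \<omega>) \<partial>N)"
        using ik by (simp add: N.prob_space)
      also have "\<dots> \<le> e + 2 * B * e" using Zk B by (simp add: mult_left_mono)
      finally show ?thesis .
    qed
    show ?thesis
      using ev1 ev2 ev3 H(2)
    proof eventually_elim
      case (elim n)
      have Yn: "Y n \<omega> \<in> mspace m" if "\<omega> \<in> space M" for \<omega>
        using measurable_space[OF Y that] by simp
      have iH: "integrable M (H n)"
        using H(1) elim(4) Yn bdd(1) by (intro M.integrable_const_bound[of _ B]) auto
      have i\<psi>: "integrable M (\<lambda>\<omega>. \<psi> (Y n \<omega>))"
        using Y[of n] \<psi>B by (intro M.integrable_const_bound[of _ B]) auto
      have ik: "integrable M (\<lambda>\<omega>. k (Y n \<omega>))"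
        using Y[of n] k01 by (intro M.integrable_const_bound[of _ 1]) auto
      have "\<bar>(\<integral>\<omega>. H n \<omega> \<partial>M) - (\<integral>\<omega>. \<psi> (Y n \<omega>) \<partial>M)\<bar> = \<bar>\<integral>\<omega>. H n \<omega> - \<psi> (Y n \<omega>) \<partial>M\<bar>"
        using iH i\<psi> by simp
      also have "\<dots> \<le> (\<integral>\<omega>. \<bar>H n \<omega> - \<psi> (Y n \<omega>)\<bar> \<partial>M)" by (rule integral_abs_bound)
      also have "\<dots> \<le> (\<integral>\<omega>. e + 2 * B * k (Y n \<omega>) \<partial>M)"
      proof (rule integral_mono)
        fix \<omega> assume \<omega>: "\<omega> \<in> space M"
        show "\<bar>H n \<omega> - \<psi> (Y n \<omega>)\<bar> \<le> e + 2 * B * k (Y n \<omega>)"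
        proof (rule key)
          show "\<bar>H n \<omega> - c i\<bar> \<le> e" if "i \<in> J" "Y n \<omega> \<in> mball_of m (fst i) (fst (snd i))" for i
            using cn[OF that, of n] elim(3,4) that(1) \<omega> by simp
        qed (use elim(4) \<omega> Yn bdd(1) in auto)
      qed (use iH i\<psi> ik in auto)
      also have "\<dots> = e + 2 * B * (\<integral>\<omega>. k (Y n \<omega>) \<partial>M)"
        using ik by (simp add: M.prob_space)
      also have "\<dots> \<le> e + 2 * B * (2 * e)" using elim(1) B by (intro add_left_mono mult_left_mono) auto
      finally have "\<bar>(\<integral>\<omega>. H n \<omega> \<partial>M) - (\<integral>\<omega>. \<psi> (Y n \<omega>) \<partial>M)\<bar> \<le> e + 4 * (B * e)" by simp
      moreover have "\<bar>(\<integral>\<omega>. \<psi> (Y n \<omega>) \<partial>M) - (\<integral>\<omega>. \<psi> (Z \<omega>) \<partial>N)\<bar> < e"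
        using elim(2) by (simp add: dist_real_def)
      moreover have "B * e \<ge> 0" using B e by simp
      ultimately have "\<bar>(\<integral>\<omega>. H n \<omega> \<partial>M) - (\<integral>\<omega>. L \<omega> \<partial>N)\<bar> \<le> 3 * e + 8 * (B * e)"
        using L\<psi> by linarith
      then show ?case by (simp add: algebra_simps)
    qed
  qed
  show ?thesis
  proof (rule tendstoI)
    fix r :: real assume r: "r > 0"
    define e where "e = r / (2 * (3 + 8 * B))"
    have "3 + 8 * B > 0" using B by simp
    then have "(3 + 8 * B) * e = r / 2" "e > 0" using r unfolding e_def by (auto simp: field_simps)
    then have less: "x < r" if "x \<le> (3 + 8 * B) * e" for x using that r by linarith
    show "\<forall>\<^sub>F n in sequentially. dist (\<integral>\<omega>. H n \<omega> \<partial>M) (\<integral>\<omega>. L \<omega> \<partial>N) < r"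
      using approx[OF \<open>e > 0\<close>] by (rule eventually_mono) (simp only: dist_real_def less)
  qed
qed

text \<open>Weak convergence on the line is tested by the functions \<open>cts_step\<close>, which
  are bounded by 1, so the bounded statement \<open>expectation_tendsto\<close> applies although
  \<open>G\<close> may be unbounded.\<close>

lemma converges_in_law_functional:
  fixes G :: "'d \<Rightarrow> real" and Gn :: "nat \<Rightarrow> 'd \<Rightarrow> real"
  assumes lim: "\<And>z. z \<in> C \<Longrightarrow>
        ((\<lambda>(n, f). Gn n f) \<longlongrightarrow> G z) (sequentially \<times>\<^sub>F nhdsin (mtopology_of m) z)"
    and H: "\<And>n. H n \<in> borel_measurable M" "\<forall>\<^sub>F n in sequentially. \<forall>\<omega>\<in>space M. H n \<omega> = Gn n (Y n \<omega>)"
    and L: "AE \<omega> in N. L \<omega> = G (Z \<omega>)"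
  shows "converges_in_law M H N L"
proof -
  obtain \<Omega> where \<Omega>: "\<Omega> \<in> sets N" "\<And>\<omega>. \<omega> \<in> \<Omega> \<Longrightarrow> Z \<omega> \<in> C" "AE \<omega> in N. \<omega> \<in> \<Omega>"
    using AE_subset_setsE[OF Z(2)] by blast
  define L' where "L' \<omega> = (if \<omega> \<in> \<Omega> then G (Z \<omega>) else 0)" for \<omega>
  have L'[measurable]: "L' \<in> borel_measurable N"
    unfolding L'_def
    by (rule measurable_version[OF Q C dense continuous_limit_of_joint_limits[OF C lim] Z(1) \<Omega>(1,2)])
  have eq: "AE \<omega> in N. G (Z \<omega>) = L' \<omega>"
    using \<Omega>(3) by eventually_elim (simp add: L'_def)
  have "weak_conv_m (\<lambda>n. distr M borel (H n)) (distr N borel L')"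
  proof (rule integral_cts_step_conv_imp_weak_conv)
    show "real_distribution (distr M borel (H n))" for n
      by (intro M.real_distribution_distr H)
    show "real_distribution (distr N borel L')"
      by (intro N.real_distribution_distr L')
    fix x y :: real assume xy: "x < y"
    have cont: "continuous_on UNIV (cts_step x y)"
      by (intro uniformly_continuous_imp_continuous cts_step_uniformly_continuous xy)
    then have [measurable]: "cts_step x y \<in> borel_measurable borel"
      by (rule borel_measurable_continuous_onI)
    have "(\<lambda>n. \<integral>\<omega>. cts_step x y (H n \<omega>) \<partial>M) \<longlonglongrightarrow> (\<integral>\<omega>. cts_step x y (L' \<omega>) \<partial>N)"
    proof (rule expectation_tendsto[where Gn = "\<lambda>n f. cts_step x y (Gn n f)"
          and G = "\<lambda>f. cts_step x y (G f)" and B = 1])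
      fix z assume "z \<in> C"
      have "((\<lambda>p. cts_step x y (case p of (n, f) \<Rightarrow> Gn n f)) \<longlongrightarrow> cts_step x y (G z))
          (sequentially \<times>\<^sub>F nhdsin (mtopology_of m) z)"
        by (rule continuous_on_tendsto_compose[OF cont lim[OF \<open>z \<in> C\<close>]]) auto
      then show "((\<lambda>(n, f). cts_step x y (Gn n f)) \<longlongrightarrow> cts_step x y (G z))
          (sequentially \<times>\<^sub>F nhdsin (mtopology_of m) z)"
        by (simp add: case_prod_beta')
    next
      show "\<forall>\<^sub>F n in sequentially. \<forall>\<omega>\<in>space M. cts_step x y (H n \<omega>) = cts_step x y (Gn n (Y n \<omega>))"
        using H(2) by eventually_elim simp
    next
      show "AE \<omega> in N. cts_step x y (G (Z \<omega>)) = cts_step x y (L' \<omega>)"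
        using eq by eventually_elim simp
    qed (use H(1) xy in \<open>auto simp: cts_step_def\<close>)
    then show "(\<lambda>n. integral\<^sup>L (distr M borel (H n)) (cts_step x y)) \<longlonglongrightarrow>
        integral\<^sup>L (distr N borel L') (cts_step x y)"
      using H(1) by (simp add: integral_distr)
  qed
  moreover have "AE \<omega> in N. L \<omega> = L' \<omega>" using L eq by eventually_elim simp
  ultimately show ?thesis
    unfolding converges_in_law_def using H(1) L' by blast
qed

end

section \<open>Uniform limits over compact parameter sets\<close>

text \<open>Joint convergence at \<open>t\<close> controls a whole neighbourhood of \<open>t\<close>
  for all late \<open>i\<close>; finitely many such neighbourhoods cover \<open>T\<close>.
  Continuity of \<open>l\<close> follows from the joint limits without any continuity of
  \<open>f i\<close>, which matters because the functions used later are steps in \<tau>.\<close>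

lemma uniform_limit_compactI:
  fixes f :: "'i \<Rightarrow> 'x::topological_space \<Rightarrow> real"
  assumes T: "compact T" and F: "F \<noteq> bot"
    and lim: "\<And>t. t \<in> T \<Longrightarrow> ((\<lambda>(i, x). f i x) \<longlongrightarrow> l t) (F \<times>\<^sub>F inf (nhds t) (principal T))"
  shows "uniform_limit T f l F" and "continuous_on T l"
proof -
  have pt: "((\<lambda>i. f i t) \<longlongrightarrow> l t) F" if "t \<in> T" for t
    using lim[OF that]
  proof (rule tendsto_fixed_snd)
    show "P t" if "eventually P (inf (nhds t) (principal T))" for P
      using that \<open>t \<in> T\<close> eventually_nhds_x_imp_x unfolding eventually_inf_principal by blast
  qed
  have "\<forall>\<^sub>F x in inf (nhds t) (principal T). ((\<lambda>i. f i x) \<longlongrightarrow> l x) F" for t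
    unfolding eventually_inf_principal using pt by (intro always_eventually) blast
  then have cl: "(l \<longlongrightarrow> l t) (inf (nhds t) (principal T))" if "t \<in> T" for t
    by (rule tendsto_limit_of_limits[OF lim[OF that] _ F])
  show "continuous_on T l"
    unfolding continuous_on_def
  proof
    fix t assume "t \<in> T"
    show "(l \<longlongrightarrow> l t) (at t within T)"
      by (rule tendsto_mono[OF _ cl[OF \<open>t \<in> T\<close>]]) (unfold at_within_def, rule inf_mono, auto)
  qed
  show "uniform_limit T f l F"
  proof (rule uniform_limitI)
    fix e :: real assume "e > 0"
    have "\<exists>U. open U \<and> t \<in> U \<and> (\<forall>\<^sub>F i in F. \<forall>x\<in>U \<inter> T. dist (f i x) (l x) < e)" if t: "t \<in> T" for t
    proof -
      have "\<forall>\<^sub>F p in F \<times>\<^sub>F inf (nhds t) (principal T). dist (case p of (i, x) \<Rightarrow> f i x) (l t) < e / 2"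
        using \<open>e > 0\<close> by (intro tendstoD lim t) auto
      then obtain P Q where P: "eventually P F" and Q: "eventually Q (inf (nhds t) (principal T))"
        and PQ: "\<And>i x. P i \<Longrightarrow> Q x \<Longrightarrow> dist (f i x) (l t) < e / 2"
        unfolding eventually_prod_filter by (simp only: prod.case) blast
      have "\<forall>\<^sub>F x in inf (nhds t) (principal T). dist (l x) (l t) < e / 2"
        using \<open>e > 0\<close> by (intro tendstoD cl t) auto
      from eventually_conj[OF Q this] obtain U where U: "open U" "t \<in> U"
        "\<And>x. x \<in> U \<inter> T \<Longrightarrow> Q x \<and> dist (l x) (l t) < e / 2"
        unfolding eventually_inf_principal eventually_nhds by blast
      have "dist (f i x) (l x) < e" if "P i" "x \<in> U \<inter> T" for i x
        using PQ[OF that(1), of x] U(3)[OF that(2)] dist_triangle2[of "f i x" "l x" "l t"] by linarith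
      then have "\<forall>\<^sub>F i in F. \<forall>x\<in>U \<inter> T. dist (f i x) (l x) < e"
        using P by (intro eventually_mono[OF P]) blast
      then show ?thesis using U by blast
    qed
    then have "\<exists>U. \<forall>t\<in>T. open (U t) \<and> t \<in> U t \<and> (\<forall>\<^sub>F i in F. \<forall>x\<in>U t \<inter> T. dist (f i x) (l x) < e)"
      by (intro bchoice ballI)
    then obtain U where U: "\<And>t. t \<in> T \<Longrightarrow> open (U t)" "\<And>t. t \<in> T \<Longrightarrow> t \<in> U t"
      "\<And>t. t \<in> T \<Longrightarrow> \<forall>\<^sub>F i in F. \<forall>x\<in>U t \<inter> T. dist (f i x) (l x) < e"
      by blast
    obtain T' where T': "T' \<subseteq> T" "finite T'" "T \<subseteq> (\<Union>t\<in>T'. U t)"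
    proof (rule compactE_image[OF T])
      show "open (U t)" if "t \<in> T" for t by (rule U(1)[OF that])
      show "T \<subseteq> (\<Union>t\<in>T. U t)" using U(2) by blast
    qed
    have "\<forall>\<^sub>F i in F. \<forall>t\<in>T'. \<forall>x\<in>U t \<inter> T. dist (f i x) (l x) < e"
      using T' U(3) by (subst eventually_ball_finite_distrib) auto
    then show "\<forall>\<^sub>F i in F. \<forall>x\<in>T. dist (f i x) (l x) < e"
      by (rule eventually_mono) (use T' in blast)
  qed
qed

lemma uniform_limit_SUP:
  fixes f :: "'i \<Rightarrow> 'x \<Rightarrow> real"
  assumes lim: "uniform_limit T f l F" and T: "T \<noteq> {}" and bdd: "bounded (l ` T)"
  shows "((\<lambda>i. SUP t\<in>T. f i t) \<longlongrightarrow> (SUP t\<in>T. l t)) F"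
proof (rule tendstoI)
  fix e :: real assume "e > 0"
  obtain K where K: "\<And>t. t \<in> T \<Longrightarrow> \<bar>l t\<bar> \<le> K" using bdd by (auto simp: bounded_iff)
  have "\<forall>\<^sub>F i in F. \<forall>t\<in>T. dist (f i t) (l t) < e / 2"
    by (rule uniform_limitD[OF lim]) (use \<open>e > 0\<close> in simp)
  then show "\<forall>\<^sub>F i in F. dist (SUP t\<in>T. f i t) (SUP t\<in>T. l t) < e"
  proof eventually_elim
    case (elim i)
    then have le: "f i t \<le> l t + e / 2" "l t \<le> f i t + e / 2" if "t \<in> T" for t
      using that unfolding dist_real_def by (smt (verit, best))+
    have bl: "bdd_above (l ` T)" using K by (force simp: bdd_above_def abs_le_iff)
    \<comment> \<open>Uniform closeness transfers boundedness from \<open>l\<close> to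
      \<open>f i\<close>, so that both \<open>SUP\<close> terms are true suprema.\<close>
    have bf: "bdd_above (f i ` T)" using K le by (intro bdd_aboveI2[of _ _ "K + e / 2"]) force
    have "(SUP t\<in>T. f i t) \<le> (SUP t\<in>T. l t) + e / 2"
      using le cSUP_upper[OF _ bl] by (intro cSUP_least T) force
    moreover have "(SUP t\<in>T. l t) \<le> (SUP t\<in>T. f i t) + e / 2"
      using le cSUP_upper[OF _ bf] by (intro cSUP_least T) force
    ultimately show ?case using \<open>e > 0\<close> by (simp add: dist_real_def abs_less_iff)
  qed
qed

lemma uniform_limit_INF:
  fixes f :: "'i \<Rightarrow> 'x \<Rightarrow> real"
  assumes lim: "uniform_limit T f l F" and T: "T \<noteq> {}" and bdd: "bounded (l ` T)"
  shows "((\<lambda>i. INF t\<in>T. f i t) \<longlongrightarrow> (INF t\<in>T. l t)) F"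
proof -
  have "bounded ((\<lambda>t. - l t) ` T)" using bdd by (auto simp: bounded_iff)
  then have "((\<lambda>i. - (SUP t\<in>T. - f i t)) \<longlongrightarrow> - (SUP t\<in>T. - l t)) F"
    using uniform_limit_uminus[OF lim] T by (intro tendsto_minus uniform_limit_SUP) auto
  then show ?thesis by (simp add: Inf_real_def image_image)
qed

lemma uniform_limit_integral_tendsto:
  fixes f :: "'i \<Rightarrow> real \<Rightarrow> real"
  assumes lim: "uniform_limit {a..b} f l F" and "a \<le> b"
    and f: "\<forall>\<^sub>F i in F. f i integrable_on {a..b}" and l: "l integrable_on {a..b}"
  shows "((\<lambda>i. integral {a..b} (f i)) \<longlongrightarrow> integral {a..b} l) F"
proof (rule tendstoI)
  fix e :: real assume "e > 0"
  \<comment> \<open>The added 1 makes the denominator positive when \<open>a = b\<close> and the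
    final inequality strict.\<close>
  define d where "d = e / (b - a + 1)"
  have d: "d > 0" "d * (b - a) < e" using \<open>e > 0\<close> \<open>a \<le> b\<close> by (auto simp: d_def field_simps)
  have "\<forall>\<^sub>F i in F. \<forall>t\<in>{a..b}. dist (f i t) (l t) < d"
    using uniform_limitD[OF lim d(1)] .
  with f show "\<forall>\<^sub>F i in F. dist (integral {a..b} (f i)) (integral {a..b} l) < e"
  proof eventually_elim
    case (elim i)
    have "norm (integral {a..b} (\<lambda>t. f i t - l t)) \<le> integral {a..b} (\<lambda>t. d)"
      using elim l by (intro integral_norm_bound_integral integrable_diff) (auto simp: dist_real_def less_imp_le)
    then show ?case using elim l d \<open>a \<le> b\<close> by (simp add: Henstock_Kurzweil_Integration.integral_diff dist_real_def mult.commute)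
  qed
qed

section \<open>The variance functional along grids\<close>

text \<open>The index is an arbitrary filter because it will be a pair of a sample size and a path,
  and later also carry a time \<tau>; \<open>N i\<close> is the number of grid cells at index
  \<open>i\<close>.\<close>

definition grid_close :: "'i filter \<Rightarrow> ('i \<Rightarrow> nat) \<Rightarrow> ('i \<Rightarrow> nat \<Rightarrow> real) \<Rightarrow> (real \<Rightarrow> real) \<Rightarrow> bool" where
  "grid_close F N y g \<longleftrightarrow>
    (\<forall>e>0. \<forall>\<^sub>F i in F. \<forall>j\<le>N i. \<bar>y i j - g (real j / real (N i))\<bar> < e)"

lemma eventually_gt_0:
  fixes N :: "'i \<Rightarrow> nat"
  assumes "filterlim N at_top F"
  shows "\<forall>\<^sub>F i in F. N i > 0"
proof -
  have "\<forall>\<^sub>F i in F. 1 \<le> N i" using assms by (simp add: filterlim_at_top)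
  then show ?thesis by (rule eventually_mono) simp
qed

lemma grid_point: "j \<le> n \<Longrightarrow> real j / real n \<in> {0..1}"
  by (auto simp: divide_simps)

lemma grid_closeD:
  "grid_close F N y g \<Longrightarrow> e > 0 \<Longrightarrow> \<forall>\<^sub>F i in F. \<forall>j\<le>N i. \<bar>y i j - g (real j / real (N i))\<bar> < e"
  by (simp add: grid_close_def)

lemma grid_close_power2:
  assumes y: "grid_close F N y g" and g: "continuous_on {0..1} g"
  shows "grid_close F N (\<lambda>i j. (y i j)\<^sup>2) (\<lambda>u. (g u)\<^sup>2)"
  unfolding grid_close_def
proof (intro allI impI)
  fix e :: real assume e: "e > 0"
  have "bounded (g ` {0..1})" by (intro compact_imp_bounded compact_continuous_image g) auto
  then have "\<exists>B. \<forall>u\<in>{0..1}. \<bar>g u\<bar> \<le> B" by (simp add: bounded_iff)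
  then obtain B where B: "\<And>u. u \<in> {0..1} \<Longrightarrow> \<bar>g u\<bar> \<le> B" by blast
  have "\<bar>g 0\<bar> \<le> B" by (rule B) simp
  then have B0: "B \<ge> 0" by linarith
  \<comment> \<open>The cap 1 bounds the second factor of \<open>(y - g) * ((y - g) + 2 * g)\<close>
    by \<open>1 + 2 * B\<close>.\<close>
  define d where "d = min 1 (e / (1 + 2 * B))"
  have d: "d > 0" "d \<le> 1" using e B0 by (auto simp: d_def)
  have "d \<le> e / (1 + 2 * B)" by (simp add: d_def)
  then have de: "d * (1 + 2 * B) \<le> e" using B0 by (simp add: pos_le_divide_eq)
  show "\<forall>\<^sub>F i in F. \<forall>j\<le>N i. \<bar>(y i j)\<^sup>2 - (g (real j / real (N i)))\<^sup>2\<bar> < e"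
    using grid_closeD[OF y d(1)]
  proof eventually_elim
    case (elim i)
    show ?case
    proof (intro allI impI)
      fix j assume j: "j \<le> N i"
      let ?g = "g (real j / real (N i))"
      have a: "\<bar>y i j - ?g\<bar> < d" "\<bar>?g\<bar> \<le> B" using elim j B[OF grid_point] by auto
      have "(y i j)\<^sup>2 - ?g\<^sup>2 = (y i j - ?g) * ((y i j - ?g) + 2 * ?g)"
        by (simp add: power2_eq_square algebra_simps)
      then have "\<bar>(y i j)\<^sup>2 - ?g\<^sup>2\<bar> = \<bar>y i j - ?g\<bar> * \<bar>(y i j - ?g) + 2 * ?g\<bar>"
        by (simp add: abs_mult)
      also have "\<dots> \<le> \<bar>y i j - ?g\<bar> * (1 + 2 * B)"
        using a d by (intro mult_left_mono) auto
      also have "\<dots> < d * (1 + 2 * B)" using a B0 by (intro mult_strict_right_mono) auto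
      finally show "\<bar>(y i j)\<^sup>2 - ?g\<^sup>2\<bar> < e" using de by simp
    qed
  qed
qed

text \<open>Each cell of length \<open>1 / n\<close> contributes at most \<open>2 * e / n\<close>:
  one \<open>e\<close> for replacing \<open>y\<close> by \<open>g\<close> at the right end of the
  cell, one for the oscillation of \<open>g\<close> inside it.\<close>

lemma Riemann_sum_error:
  fixes y :: "nat \<Rightarrow> real"
  assumes g: "continuous_on {0..1} g" and n: "n > 0" and k: "k \<le> n"
    and y: "\<And>j. j \<le> n \<Longrightarrow> \<bar>y j - g (real j / real n)\<bar> \<le> e"
    and osc: "\<And>u v. u \<in> {0..1} \<Longrightarrow> v \<in> {0..1} \<Longrightarrow> \<bar>u - v\<bar> \<le> 1 / real n \<Longrightarrow> \<bar>g u - g v\<bar> \<le> e"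
  shows "\<bar>(\<Sum>j=1..k. y j) / real n - integral {0..real k / real n} g\<bar> \<le> 2 * e * (real k / real n)"
  using k
proof (induction k)
  case 0
  show ?case by simp
next
  case (Suc k)
  define a b where "a = real k / real n" and "b = real (Suc k) / real n"
  have ab: "0 \<le> a" "a \<le> b" "b \<le> 1" "b - a = 1 / real n"
    using Suc.prems n by (auto simp: a_def b_def field_simps)
  have gi: "g integrable_on {u..v}" if "0 \<le> u" "v \<le> 1" for u v
    using that by (intro integrable_continuous_interval continuous_on_subset[OF g]) auto
  have split: "integral {0..a} g + integral {a..b} g = integral {0..b} g"
    using ab gi by (intro Henstock_Kurzweil_Integration.integral_combine) auto
  have "norm (integral {a..b} (\<lambda>u. y (Suc k) - g u)) \<le> integral {a..b} (\<lambda>u. 2 * e)"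
  proof (rule integral_norm_bound_integral)
    fix u assume u: "u \<in> {a..b}"
    have "\<bar>g b - g u\<bar> \<le> e" using u ab by (intro osc) auto
    then show "norm (y (Suc k) - g u) \<le> 2 * e" using y[OF Suc.prems] unfolding b_def[symmetric] by auto
  qed (use gi ab in \<open>auto intro!: integrable_diff\<close>)
  moreover have "integral {a..b} (\<lambda>u. y (Suc k) - g u) = y (Suc k) / real n - integral {a..b} g"
    using ab by (subst Henstock_Kurzweil_Integration.integral_diff) (auto intro!: gi)
  ultimately have "\<bar>y (Suc k) / real n - integral {a..b} g\<bar> \<le> 2 * e / real n"
    using ab by simp
  then have "\<bar>(\<Sum>j=1..k. y j) / real n - integral {0..a} g + (y (Suc k) / real n - integral {a..b} g)\<bar>
      \<le> 2 * e * a + 2 * e / real n"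
    using Suc unfolding a_def[symmetric] by linarith
  also have "(\<Sum>j=1..k. y j) / real n - integral {0..a} g + (y (Suc k) / real n - integral {a..b} g)
      = (\<Sum>j=1..Suc k. y j) / real n - integral {0..b} g"
    using split by (simp add: add_divide_distrib)
  also have "2 * e * a + 2 * e / real n = 2 * e * b" using n by (simp add: a_def b_def field_simps)
  finally show ?case unfolding b_def .
qed

text \<open>Two errors are separated: the sum against the integral up to the moving grid point
  \<open>\<kappa> i / N i\<close>, and that integral against the one up to \<open>s\<close>, by
  continuity of the indefinite integral.\<close>

lemma grid_close_sum_tendsto:
  assumes y: "grid_close F N y g" and g: "continuous_on {0..1} g"
    and N: "filterlim N at_top F" and \<kappa>: "\<forall>\<^sub>F i in F. \<kappa> i \<le> N i"
    and s: "((\<lambda>i. real (\<kappa> i) / real (N i)) \<longlongrightarrow> s) F" "s \<in> {0..1}"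
  shows "((\<lambda>i. (\<Sum>j=1..\<kappa> i. y i j) / real (N i)) \<longlongrightarrow> integral {0..s} g) F"
proof -
  have "continuous_on {0..1} (\<lambda>x. integral {0..x} g)"
    by (intro indefinite_integral_continuous_1 integrable_continuous_interval g)
  then have lim: "((\<lambda>i. integral {0..real (\<kappa> i) / real (N i)} g) \<longlongrightarrow> integral {0..s} g) F"
    using s by (rule continuous_on_tendsto_compose) (rule eventually_mono[OF \<kappa> grid_point])
  have "((\<lambda>i. (\<Sum>j=1..\<kappa> i. y i j) / real (N i) - integral {0..real (\<kappa> i) / real (N i)} g) \<longlongrightarrow> 0) F"
  proof (rule tendstoI)
    fix e :: real assume e: "e > 0"
    have "uniformly_continuous_on {0..1} g" using g by (intro compact_uniformly_continuous) auto
    then obtain d where d: "d > 0" "\<And>u v. u \<in> {0..1} \<Longrightarrow> v \<in> {0..1} \<Longrightarrow> dist v u < d \<Longrightarrow> dist (g v) (g u) < e / 4"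
      using e unfolding uniformly_continuous_on_def
      by (elim allE[of _ "e / 4"] impE exE conjE) (simp, blast)
    obtain n0 where n0: "1 / d < real n0" using reals_Archimedean2 by blast
    have "\<forall>\<^sub>F i in F. N i \<ge> Suc n0" using N by (auto simp: filterlim_at_top)
    moreover have "\<forall>\<^sub>F i in F. \<forall>j\<le>N i. \<bar>y i j - g (real j / real (N i))\<bar> < e / 4"
      using e by (intro grid_closeD[OF y]) simp
    ultimately show "\<forall>\<^sub>F i in F. dist ((\<Sum>j=1..\<kappa> i. y i j) / real (N i) - integral {0..real (\<kappa> i) / real (N i)} g) 0 < e"
      using \<kappa>
    proof eventually_elim
      case (elim i)
      have n: "1 / real (N i) < d"
      proof -
        have "1 / d < real (N i)" using n0 elim(1) by linarith
        then show ?thesis using d(1) elim(1) by (simp add: field_simps)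
      qed
      have "\<bar>(\<Sum>j=1..\<kappa> i. y i j) / real (N i) - integral {0..real (\<kappa> i) / real (N i)} g\<bar>
          \<le> 2 * (e / 4) * (real (\<kappa> i) / real (N i))"
      proof (rule Riemann_sum_error[OF g])
        fix u v :: real assume "u \<in> {0..1}" "v \<in> {0..1}" "\<bar>u - v\<bar> \<le> 1 / real (N i)"
        then show "\<bar>g u - g v\<bar> \<le> e / 4" using d(2)[of v u] n by (auto simp: dist_real_def)
      qed (use elim in \<open>auto intro: less_imp_le\<close>)
      also have "\<dots> \<le> 2 * (e / 4) * 1"
        using e grid_point[OF elim(3)] by (intro mult_left_mono) auto
      finally show ?case using e by simp
    qed
  qed
  from tendsto_add[OF this lim] show ?thesis by simp
qed

text \<open>This is \<open>1 / k\<close> times the empirical variance of the bridge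
  \<open>y j - j / k * y k\<close>, \<open>j = 1..k\<close>; the power 3/2 in the statistics becomes
  \<open>k ^ 3\<close> after squaring. Taking an arbitrary sequence \<open>y\<close> lets forward
  sums, backward sums and path values share one functional.\<close>

definition cs_var :: "(nat \<Rightarrow> real) \<Rightarrow> nat \<Rightarrow> real" where
  "cs_var y k = (\<Sum>j=1..k. (y j - real j / real k * y k)\<^sup>2) / real k ^ 2
     - (\<Sum>j=1..k. y j - real j / real k * y k)\<^sup>2 / real k ^ 3"

text \<open>After multiplication by \<open>N\<close>, both terms become Riemann sums with weight
  \<open>1 / N\<close> divided by powers of \<open>\<kappa> / N\<close>, which tends to
  \<open>s > 0\<close>. The limit is \<open>Q_fun s z\<close> with its factor
  \<open>1 / s\<^sup>2\<close> multiplied out.\<close>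

lemma cs_var_tendsto_Q_fun:
  assumes y: "grid_close F N y z" and z: "continuous_on {0..1} z"
    and N: "filterlim N at_top F" and \<kappa>: "\<forall>\<^sub>F i in F. \<kappa> i \<le> N i"
    and s: "((\<lambda>i. real (\<kappa> i) / real (N i)) \<longlongrightarrow> s) F" "0 < s" "s \<le> 1"
  shows "((\<lambda>i. real (N i) * cs_var (y i) (\<kappa> i)) \<longlongrightarrow> Q_fun s z) F"
proof -
  define d where "d u = z u - u / s * z s" for u
  define D where "D i j = y i j - real j / real (\<kappa> i) * y i (\<kappa> i)" for i j
  have cd: "continuous_on {0..1} d"
    unfolding d_def using s by (intro continuous_intros z) auto
  have "((\<lambda>i. z (real (\<kappa> i) / real (N i))) \<longlongrightarrow> z s) F"
    using s by (intro continuous_on_tendsto_compose[OF z s(1)] eventually_mono[OF \<kappa> grid_point]) auto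
  moreover have "((\<lambda>i. y i (\<kappa> i) - z (real (\<kappa> i) / real (N i))) \<longlongrightarrow> 0) F"
  proof (rule tendstoI)
    fix e :: real assume "e > 0"
    from grid_closeD[OF y this] \<kappa>
    show "\<forall>\<^sub>F i in F. dist (y i (\<kappa> i) - z (real (\<kappa> i) / real (N i))) 0 < e"
      by eventually_elim simp
  qed
  ultimately have "((\<lambda>i. y i (\<kappa> i)) \<longlongrightarrow> z s) F"
    using tendsto_add by fastforce
  then have c: "((\<lambda>i. y i (\<kappa> i) / (real (\<kappa> i) / real (N i))) \<longlongrightarrow> z s / s) F"
    using s by (intro tendsto_divide) auto
  have N0: "\<forall>\<^sub>F i in F. N i > 0" by (rule eventually_gt_0[OF N])
  have \<kappa>0: "\<forall>\<^sub>F i in F. \<kappa> i > 0"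
    using order_tendstoD(1)[OF s(1,2)] by eventually_elim (auto intro: gr0I)
  have Dd: "grid_close F N D d"
    unfolding grid_close_def
  proof (intro allI impI)
    fix e :: real assume "e > 0"
    then have "\<forall>\<^sub>F i in F. dist (y i (\<kappa> i) / (real (\<kappa> i) / real (N i))) (z s / s) < e / 2"
      using c by (intro tendstoD) auto
    moreover have "\<forall>\<^sub>F i in F. \<forall>j\<le>N i. \<bar>y i j - z (real j / real (N i))\<bar> < e / 2"
      using \<open>e > 0\<close> by (intro grid_closeD[OF y]) simp
    ultimately show "\<forall>\<^sub>F i in F. \<forall>j\<le>N i. \<bar>D i j - d (real j / real (N i))\<bar> < e"
      using N0 \<kappa>0
    proof eventually_elim
      case (elim i)
      show ?case
      proof (intro allI impI)
        fix j assume j: "j \<le> N i"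
        let ?u = "real j / real (N i)"
        let ?c = "y i (\<kappa> i) / (real (\<kappa> i) / real (N i)) - z s / s"
        \<comment> \<open>Writing the slope as \<open>y i (\<kappa> i) / (\<kappa> i / N i)\<close>
          gives an error \<open>?c\<close> that does not depend on \<open>j\<close>; its weight
          \<open>?u\<close> is at most 1.\<close>
        have "D i j - d ?u = (y i j - z ?u) - ?u * ?c"
          using elim s by (simp add: D_def d_def field_simps)
        moreover have "\<bar>?u * ?c\<bar> \<le> \<bar>?c\<bar>"
          unfolding abs_mult using grid_point[OF j] by (intro mult_left_le_one_le) auto
        moreover have "\<bar>?c\<bar> < e / 2" using elim by (simp add: dist_real_def)
        moreover have "\<bar>y i j - z ?u\<bar> < e / 2" using elim(2) j by blast
        ultimately show "\<bar>D i j - d ?u\<bar> < e" by linarith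
      qed
    qed
  qed
  have "((\<lambda>i. (\<Sum>j=1..\<kappa> i. D i j) / real (N i)) \<longlongrightarrow> integral {0..s} d) F"
    using s by (intro grid_close_sum_tendsto[OF Dd cd N \<kappa>]) auto
  moreover have "((\<lambda>i. (\<Sum>j=1..\<kappa> i. (D i j)\<^sup>2) / real (N i)) \<longlongrightarrow> integral {0..s} (\<lambda>u. (d u)\<^sup>2)) F"
    using s by (intro grid_close_sum_tendsto[OF grid_close_power2[OF Dd cd] _ N \<kappa>] continuous_intros cd) auto
  ultimately have "((\<lambda>i. ((\<Sum>j=1..\<kappa> i. (D i j)\<^sup>2) / real (N i)) / (real (\<kappa> i) / real (N i))\<^sup>2
      - ((\<Sum>j=1..\<kappa> i. D i j) / real (N i))\<^sup>2 / (real (\<kappa> i) / real (N i)) ^ 3)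
      \<longlongrightarrow> integral {0..s} (\<lambda>u. (d u)\<^sup>2) / s\<^sup>2 - (integral {0..s} d)\<^sup>2 / s ^ 3) F"
    using s by (intro tendsto_intros) auto
  also have "integral {0..s} (\<lambda>u. (d u)\<^sup>2) / s\<^sup>2 - (integral {0..s} d)\<^sup>2 / s ^ 3 = Q_fun s z"
    unfolding Q_fun_def d_def using s by (simp add: field_simps power2_eq_square power3_eq_cube)
  finally show ?thesis
  proof (rule Lim_transform_eventually)
    show "\<forall>\<^sub>F i in F. ((\<Sum>j=1..\<kappa> i. (D i j)\<^sup>2) / real (N i)) / (real (\<kappa> i) / real (N i))\<^sup>2
      - ((\<Sum>j=1..\<kappa> i. D i j) / real (N i))\<^sup>2 / (real (\<kappa> i) / real (N i)) ^ 3
      = real (N i) * cs_var (y i) (\<kappa> i)"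
      using N0 \<kappa>0
    proof eventually_elim
      case (elim i)
      have "(a / n) / (k / n)\<^sup>2 - (b / n)\<^sup>2 / (k / n) ^ 3 = n * (a / k\<^sup>2 - b\<^sup>2 / k ^ 3)"
        if "n > 0" "k > 0" for a b n k :: real
        using that by (simp add: field_simps power2_eq_square power3_eq_cube)
      then show ?case using elim unfolding cs_var_def D_def by simp
    qed
  qed
qed

section \<open>Reversed paths and uniformity in the time parameter\<close>

lemma reversed_continuous_on:
  assumes z: "continuous_on {0..1} z"
  shows "continuous_on {0..1} (reversed z)"
proof -
  have "continuous_on {0..1} (\<lambda>u. z (1 - u))"
    by (rule continuous_on_compose2[OF z]) (auto intro!: continuous_intros)
  then have "continuous_on {0..1} (\<lambda>u. z 1 - z (1 - u))"
    by (intro continuous_on_diff continuous_on_const)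
  then show ?thesis by (simp add: reversed_def[abs_def])
qed

text \<open>Reflection maps the grid onto itself exactly, so the two evaluations of \<open>y\<close>
  cost \<open>e / 2\<close> each and no modulus of continuity of \<open>z\<close> enters.\<close>

lemma grid_close_reversed:
  assumes y: "grid_close F N y z" and N: "filterlim N at_top F"
  shows "grid_close F N (\<lambda>i j. y i (N i) - y i (N i - j)) (reversed z)"
  unfolding grid_close_def
proof (intro allI impI)
  fix e :: real assume e: "e > 0"
  have N0: "\<forall>\<^sub>F i in F. N i > 0" by (rule eventually_gt_0[OF N])
  moreover have "\<forall>\<^sub>F i in F. \<forall>j\<le>N i. \<bar>y i j - z (real j / real (N i))\<bar> < e / 2"
    using e by (intro grid_closeD[OF y]) simp
  ultimately show "\<forall>\<^sub>F i in F. \<forall>j\<le>N i. \<bar>y i (N i) - y i (N i - j) - reversed z (real j / real (N i))\<bar> < e"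
  proof eventually_elim
    case (elim i)
    show ?case
    proof (intro allI impI)
      fix j assume j: "j \<le> N i"
      have eq: "1 - real j / real (N i) = real (N i - j) / real (N i)"
        using j elim by (simp add: of_nat_diff diff_divide_distrib)
      have "real (N i) / real (N i) = 1" using elim by simp
      moreover have "\<bar>y i k - z (real k / real (N i))\<bar> < e / 2" if "k \<le> N i" for k
        using elim that by blast
      ultimately have "\<bar>y i (N i) - z 1\<bar> < e / 2"
        "\<bar>y i (N i - j) - z (real (N i - j) / real (N i))\<bar> < e / 2"
        by (metis order_refl, simp)
      then show "\<bar>y i (N i) - y i (N i - j) - reversed z (real j / real (N i))\<bar> < e"
        unfolding reversed_def eq by linarith
    qed
  qed
qed

text \<open>A sandwich between \<open>\<tau> - 1 / N\<close> and \<open>\<tau>\<close>, with \<tau>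
  itself moving towards \<open>t\<close>. The restriction to the unit interval keeps
  \<open>nat\<close> from truncating a negative floor.\<close>

lemma floor_grid_tendsto:
  assumes N: "filterlim N at_top F"
  shows "((\<lambda>(i, \<tau>). real (nat \<lfloor>real (N i) * \<tau>\<rfloor>) / real (N i)) \<longlongrightarrow> t)
    (F \<times>\<^sub>F inf (nhds t) (principal {0..1}))"
proof -
  let ?E = "F \<times>\<^sub>F inf (nhds t) (principal {0..1::real})"
  have fl: "filterlim (\<lambda>p. N (fst p)) at_top ?E"
    using N filterlim_fst by (rule filterlim_compose)
  have "((\<lambda>p. 1 / real (N (fst p))) \<longlongrightarrow> 0) ?E"
    using filterlim_compose[OF filterlim_real_sequentially fl]
    by (intro tendsto_divide_0[OF tendsto_const] filterlim_at_top_imp_at_infinity) auto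
  moreover have "(snd \<longlongrightarrow> t) ?E"
    using filterlim_snd[of "inf (nhds t) (principal {0..1})" F]
    by (rule filterlim_mono) auto
  ultimately have lo: "((\<lambda>p. snd p - 1 / real (N (fst p))) \<longlongrightarrow> t) ?E" and hi: "(snd \<longlongrightarrow> t) ?E"
    using tendsto_diff by fastforce+
  have mem: "\<forall>\<^sub>F p in ?E. snd p \<in> {0..1}"
    using eventually_prodI[of "\<lambda>_. True" F "\<lambda>x. x \<in> {0..1}" "inf (nhds t) (principal {0..1})"]
    by (simp add: eventually_inf_principal)
  have N0: "\<forall>\<^sub>F p in ?E. N (fst p) > 0" by (rule eventually_gt_0[OF fl])
  have lower: "\<forall>\<^sub>F p in ?E. snd p - 1 / real (N (fst p)) \<le> real (nat \<lfloor>real (N (fst p)) * snd p\<rfloor>) / real (N (fst p))"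
    using eventually_conj[OF mem N0]
  proof (eventually_elim)
    case (elim p)
    have "real (N (fst p)) * snd p - 1 \<le> of_int \<lfloor>real (N (fst p)) * snd p\<rfloor>"
      by linarith
    moreover have "real (nat \<lfloor>real (N (fst p)) * snd p\<rfloor>) = of_int \<lfloor>real (N (fst p)) * snd p\<rfloor>"
      using elim by simp
    ultimately have "(real (N (fst p)) * snd p - 1) / real (N (fst p))
        \<le> real (nat \<lfloor>real (N (fst p)) * snd p\<rfloor>) / real (N (fst p))"
      by (intro divide_right_mono) auto
    then show "snd p - 1 / real (N (fst p)) \<le> real (nat \<lfloor>real (N (fst p)) * snd p\<rfloor>) / real (N (fst p))"
      using elim by (simp add: diff_divide_distrib)
  qed
  have upper: "\<forall>\<^sub>F p in ?E. real (nat \<lfloor>real (N (fst p)) * snd p\<rfloor>) / real (N (fst p)) \<le> snd p"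
    using eventually_conj[OF mem N0]
  proof (eventually_elim)
    case (elim p)
    have "real (nat \<lfloor>real (N (fst p)) * snd p\<rfloor>) \<le> real (N (fst p)) * snd p"
      using elim by simp
    then show "real (nat \<lfloor>real (N (fst p)) * snd p\<rfloor>) / real (N (fst p)) \<le> snd p"
      using elim by (simp add: field_simps)
  qed
  from tendsto_sandwich[OF lower upper lo hi] show ?thesis by (simp add: case_prod_beta')
qed

lemma grid_close_prod_filter:
  assumes "grid_close F N y z"
  shows "grid_close (F \<times>\<^sub>F E) (\<lambda>p. N (fst p)) (\<lambda>p. y (fst p)) z"
  unfolding grid_close_def
proof (intro allI impI)
  fix e :: real assume "e > 0"
  from eventually_prodI[OF grid_closeD[OF assms this], of "\<lambda>_. True" E]
  show "\<forall>\<^sub>F p in F \<times>\<^sub>F E. \<forall>j\<le>N (fst p). \<bar>y (fst p) j - z (real j / real (N (fst p)))\<bar> < e"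
    by simp
qed

text \<open>With \<tau> as a further coordinate of the filter, uniformity in \<tau> reduces to
  \<open>cs_var_tendsto_Q_fun\<close> at each \<open>t\<close> plus compactness. The bounds on
  \<open>lo\<close> and \<open>hi\<close> keep the limiting fractions \<open>t\<close> and
  \<open>1 - t\<close> positive.\<close>

lemma cs_var_uniform_limit:
  assumes y: "grid_close F N y z" and z: "continuous_on {0..1} z" and F: "F \<noteq> bot"
    and N: "filterlim N at_top F" and lohi: "0 < lo" "hi < 1"
  defines "v \<equiv> \<lambda>i \<tau>. real (N i) * cs_var (y i) (nat \<lfloor>real (N i) * \<tau>\<rfloor>)"
    and "v' \<equiv> \<lambda>i \<tau>. real (N i) * cs_var (\<lambda>j. y i (N i) - y i (N i - j)) (N i - nat \<lfloor>real (N i) * \<tau>\<rfloor>)"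
  shows "uniform_limit {lo..hi} v (\<lambda>\<tau>. Q_fun \<tau> z) F"
    and "continuous_on {lo..hi} (\<lambda>\<tau>. Q_fun \<tau> z)"
    and "uniform_limit {lo..hi} v' (\<lambda>\<tau>. Q_fun (1 - \<tau>) (reversed z)) F"
    and "continuous_on {lo..hi} (\<lambda>\<tau>. Q_fun (1 - \<tau>) (reversed z))"
    and "(\<And>\<tau>. \<tau> \<in> {lo..hi} \<Longrightarrow> Q_fun \<tau> z \<noteq> 0) \<Longrightarrow>
      uniform_limit {lo..hi} (\<lambda>i \<tau>. v' i \<tau> / v i \<tau>) (\<lambda>\<tau>. Q_fun (1 - \<tau>) (reversed z) / Q_fun \<tau> z) F"
proof -
  have both: "((\<lambda>(i, \<tau>). v i \<tau>) \<longlongrightarrow> Q_fun t z) (F \<times>\<^sub>F inf (nhds t) (principal {lo..hi}))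
      \<and> ((\<lambda>(i, \<tau>). v' i \<tau>) \<longlongrightarrow> Q_fun (1 - t) (reversed z)) (F \<times>\<^sub>F inf (nhds t) (principal {lo..hi}))"
    if t: "t \<in> {lo..hi}" for t
  proof
    let ?E = "F \<times>\<^sub>F inf (nhds t) (principal {lo..hi})"
    let ?\<kappa> = "\<lambda>p. nat \<lfloor>real (N (fst p)) * snd p\<rfloor>"
    have fl: "filterlim (\<lambda>p. N (fst p)) at_top ?E"
      using N filterlim_fst by (rule filterlim_compose)
    have N0: "\<forall>\<^sub>F p in ?E. N (fst p) > 0" by (rule eventually_gt_0[OF fl])
    have sub: "?E \<le> F \<times>\<^sub>F inf (nhds t) (principal {0..1})"
      using lohi by (intro prod_filter_mono inf_mono) auto
    have lim: "((\<lambda>p. real (?\<kappa> p) / real (N (fst p))) \<longlongrightarrow> t) ?E"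
      using tendsto_mono[OF sub floor_grid_tendsto[OF N]] by (simp add: case_prod_beta')
    have mem: "\<forall>\<^sub>F p in ?E. snd p \<in> {lo..hi}"
      using eventually_prodI[of "\<lambda>_. True" F "\<lambda>x. x \<in> {lo..hi}" "inf (nhds t) (principal {lo..hi})"]
      by (simp add: eventually_inf_principal)
    then have le: "\<forall>\<^sub>F p in ?E. ?\<kappa> p \<le> N (fst p)"
    proof eventually_elim
      case (elim p)
      have "real (N (fst p)) * snd p \<le> real (N (fst p)) * 1"
        using elim lohi by (intro mult_left_mono) auto
      then show ?case by linarith
    qed
    have "((\<lambda>p. real (N (fst p)) * cs_var (y (fst p)) (?\<kappa> p)) \<longlongrightarrow> Q_fun t z) ?E"
      using t lohi by (intro cs_var_tendsto_Q_fun[OF grid_close_prod_filter[OF y] z fl le lim]) auto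
    then show "((\<lambda>(i, \<tau>). v i \<tau>) \<longlongrightarrow> Q_fun t z) ?E"
      by (simp add: v_def case_prod_beta')
    have "((\<lambda>p. 1 - real (?\<kappa> p) / real (N (fst p))) \<longlongrightarrow> 1 - t) ?E"
      by (intro tendsto_intros lim)
    then have lim': "((\<lambda>p. real (N (fst p) - ?\<kappa> p) / real (N (fst p))) \<longlongrightarrow> 1 - t) ?E"
    proof (rule Lim_transform_eventually)
      show "\<forall>\<^sub>F p in ?E. 1 - real (?\<kappa> p) / real (N (fst p)) = real (N (fst p) - ?\<kappa> p) / real (N (fst p))"
        using le N0 by eventually_elim (simp add: of_nat_diff diff_divide_distrib)
    qed
    have "((\<lambda>p. real (N (fst p)) * cs_var (\<lambda>j. y (fst p) (N (fst p)) - y (fst p) (N (fst p) - j)) (N (fst p) - ?\<kappa> p))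
        \<longlongrightarrow> Q_fun (1 - t) (reversed z)) ?E"
      using t lohi
      by (intro cs_var_tendsto_Q_fun[OF _ reversed_continuous_on[OF z] fl _ lim'] grid_close_reversed fl
          grid_close_prod_filter y) auto
    then show "((\<lambda>(i, \<tau>). v' i \<tau>) \<longlongrightarrow> Q_fun (1 - t) (reversed z)) ?E"
      by (simp add: v'_def case_prod_beta')
  qed
  show "uniform_limit {lo..hi} v (\<lambda>\<tau>. Q_fun \<tau> z) F"
    by (rule uniform_limit_compactI) (use F both in auto)
  show "continuous_on {lo..hi} (\<lambda>\<tau>. Q_fun \<tau> z)"
    by (rule uniform_limit_compactI[where f = v, OF _ F]) (use both in auto)
  show "uniform_limit {lo..hi} v' (\<lambda>\<tau>. Q_fun (1 - \<tau>) (reversed z)) F"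
    by (rule uniform_limit_compactI) (use F both in auto)
  show "continuous_on {lo..hi} (\<lambda>\<tau>. Q_fun (1 - \<tau>) (reversed z))"
    by (rule uniform_limit_compactI[where f = v', OF _ F]) (use both in auto)
  assume nz: "\<And>\<tau>. \<tau> \<in> {lo..hi} \<Longrightarrow> Q_fun \<tau> z \<noteq> 0"
  \<comment> \<open>The division is performed on the joint limits, before compactness is applied, so
    no uniform lower bound on the denominators has to be produced.\<close>
  show "uniform_limit {lo..hi} (\<lambda>i \<tau>. v' i \<tau> / v i \<tau>) (\<lambda>\<tau>. Q_fun (1 - \<tau>) (reversed z) / Q_fun \<tau> z) F"
  proof (rule uniform_limit_compactI)
    fix t assume t: "t \<in> {lo..hi}"
    from both[OF t] nz[OF t] show "((\<lambda>(i, x). v' i x / v i x) \<longlongrightarrow> Q_fun (1 - t) (reversed z) / Q_fun t z)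
          (F \<times>\<^sub>F inf (nhds t) (principal {lo..hi}))"
      unfolding case_prod_beta' by (intro tendsto_divide) auto
  qed (use F in auto)
qed

text \<open>\<open>\<tau>\<^sup>2 Q\<^sub>\<tau>(z)\<close> is the integral of the squared deviation of \<open>z(u) - u z(\<tau>) / \<tau>\<close> from its mean,
  so it vanishes only if \<open>z\<close> is linear on \<open>[0,\<tau>]\<close>.\<close>

lemma Q_fun_pos_mono:
  assumes z: "continuous_on {0..1} z" and s: "0 < s" "s \<le> t" "t \<le> 1" and pos: "Q_fun s z > 0"
  shows "Q_fun t z > 0"
proof (rule ccontr)
  assume "\<not> Q_fun t z > 0"
  define d where "d u = z u - u / t * z t" for u
  define c where "c = integral {0..t} d / t"
  have cd: "continuous_on {0..t} d"
    unfolding d_def using s by (intro continuous_intros continuous_on_subset[OF z]) auto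
  have di: "d integrable_on {0..t}" "(\<lambda>u. (d u)\<^sup>2) integrable_on {0..t}"
    by (intro integrable_continuous_interval continuous_intros cd)+
  have "((\<lambda>u. (d u)\<^sup>2 - 2 * c * d u + c\<^sup>2) has_integral
      integral {0..t} (\<lambda>u. (d u)\<^sup>2) - 2 * c * integral {0..t} d + (t - 0) *\<^sub>R c\<^sup>2) {0..t}"
    using has_integral_const_real[of "c\<^sup>2" 0 t] s
    by (intro has_integral_add has_integral_diff has_integral_mult_right integrable_integral di) simp
  then have "integral {0..t} (\<lambda>u. (d u - c)\<^sup>2)
      = integral {0..t} (\<lambda>u. (d u)\<^sup>2) - 2 * c * integral {0..t} d + t * c\<^sup>2"
    by (simp add: integral_unique power2_diff algebra_simps)
  also have "\<dots> = integral {0..t} (\<lambda>u. (d u)\<^sup>2) - 1 / t * (integral {0..t} d)\<^sup>2"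
    using s by (simp add: c_def field_simps power2_eq_square)
  also have "\<dots> = t\<^sup>2 * Q_fun t z" using s by (simp add: Q_fun_def d_def[abs_def])
  also have "\<dots> \<le> 0" using \<open>\<not> Q_fun t z > 0\<close> by (simp add: mult_nonneg_nonpos)
  finally have "integral {0..t} (\<lambda>u. (d u - c)\<^sup>2) \<le> 0" .
  moreover have "integral {0..t} (\<lambda>u. (d u - c)\<^sup>2) \<ge> 0"
    by (intro integral_nonneg integrable_continuous_interval continuous_intros cd) auto
  ultimately have "integral {0..t} (\<lambda>u. (d u - c)\<^sup>2) = 0" by simp
  moreover have "continuous_on {0..t} (\<lambda>u. (d u - c)\<^sup>2)" by (intro continuous_intros cd)
  ultimately have const: "d u = c" if "u \<in> {0..t}" for u
    using integral_eq_0_iff[of 0 t "\<lambda>u. (d u - c)\<^sup>2"] that s by auto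
  \<comment> \<open>The bridge vanishes at its right end point \<open>t\<close>, which determines
    the constant.\<close>
  have "c = 0" using const[of t] s by (simp add: d_def)
  then have lin: "z u = u / t * z t" if "u \<in> {0..t}" for u
    using const[OF that] by (simp add: d_def)
  have zero: "z u - u / s * z s = 0" if "u \<in> {0..s}" for u
  proof -
    have "u \<in> {0..t}" "s \<in> {0..t}" using that s by auto
    from lin[OF this(1)] lin[OF this(2)] have eq: "z u = u / t * z t" "z s = s / t * z t" .
    show ?thesis unfolding eq using s by simp
  qed
  have "integral {0..s} (\<lambda>u. (z u - u / s * z s)\<^sup>2) = integral {0..s} (\<lambda>u. 0)"
    by (rule integral_cong) (simp only: zero power_zero_numeral)
  moreover have "integral {0..s} (\<lambda>u. z u - u / s * z s) = integral {0..s} (\<lambda>u. 0)"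
    by (rule integral_cong) (simp only: zero)
  ultimately have "Q_fun s z = 0" by (simp add: Q_fun_def)
  then show False using pos by simp
qed

section \<open>The space \<open>D[0,1]\<close>\<close>

lemma restrict_tendsto_iff:
  assumes "\<forall>\<^sub>F s in F. s \<in> {0..1::real}"
  shows "(restrict f {0..1} \<longlongrightarrow> l) F \<longleftrightarrow> (f \<longlongrightarrow> l) F"
  using assms by (intro filterlim_cong refl) (auto elim!: eventually_rev_mp)

lemma eventually_at_right_unit:
  assumes "t \<in> {0..<1::real}"
  shows "\<forall>\<^sub>F s in at_right t. s \<in> {0..1}"
  unfolding eventually_at_right_field using assms by (intro exI[of _ 1]) auto

lemma eventually_at_left_unit:
  assumes "t \<in> {0<..1::real}"
  shows "\<forall>\<^sub>F s in at_left t. s \<in> {0..1}"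
  unfolding eventually_at_left_field using assms by (intro exI[of _ 0]) auto

lemma D_space_restrict_iff:
  "restrict f {0..1} \<in> mspace (D_space 0 1) \<longleftrightarrow>
    (\<forall>t\<in>{0..<1}. (f \<longlongrightarrow> f t) (at_right t)) \<and> (\<forall>t\<in>{0<..1}. \<exists>l. (f \<longlongrightarrow> l) (at_left t))"
proof -
  have "(restrict f {0..1} \<longlongrightarrow> l) (at_right t) \<longleftrightarrow> (f \<longlongrightarrow> l) (at_right t)" if "t \<in> {0..<1}" for t l
    using that by (intro restrict_tendsto_iff eventually_at_right_unit) auto
  moreover have "(restrict f {0..1} \<longlongrightarrow> l) (at_left t) \<longleftrightarrow> (f \<longlongrightarrow> l) (at_left t)" if "t \<in> {0<..1}" for t l
    using that by (intro restrict_tendsto_iff eventually_at_left_unit) auto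
  ultimately show ?thesis
    unfolding mspace_D_space[OF zero_le_one] cadlag_on_def by (simp add: continuous_within)
qed

text \<open>To the right of \<open>t\<close> the floor is constant up to the next grid point. Just
  to the left of \<open>t > 0\<close> it equals the ceiling at \<open>t\<close> minus 1, which
  covers grid and non-grid points alike. For \<open>n = 0\<close> the function is constant.\<close>

lemma floor_step_in_D_space:
  "(\<lambda>\<tau>\<in>{0..1}. \<phi> (nat \<lfloor>real n * \<tau>\<rfloor>)) \<in> mspace (D_space 0 1)"
  unfolding D_space_restrict_iff
proof (intro conjI ballI)
  fix t :: real assume t: "t \<in> {0..<1}"
  have "\<forall>\<^sub>F s in at_right t. \<lfloor>real n * s\<rfloor> = \<lfloor>real n * t\<rfloor>"
  proof (cases "n = 0")
    case False
    let ?b = "(of_int \<lfloor>real n * t\<rfloor> + 1) / real n"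
    have "t < ?b" using False by (simp add: pos_less_divide_eq mult.commute)
    moreover have "\<lfloor>real n * s\<rfloor> = \<lfloor>real n * t\<rfloor>" if "t < s" "s < ?b" for s
    proof -
      have "real n * t < real n * s" "real n * s < of_int \<lfloor>real n * t\<rfloor> + 1"
        using that False by (simp_all add: pos_less_divide_eq mult.commute)
      then show ?thesis by (intro floor_unique) linarith+
    qed
    ultimately show ?thesis unfolding eventually_at_right_field by blast
  qed simp
  then show "((\<lambda>\<tau>. \<phi> (nat \<lfloor>real n * \<tau>\<rfloor>)) \<longlongrightarrow> \<phi> (nat \<lfloor>real n * t\<rfloor>)) (at_right t)"
    by (intro tendsto_eventually) (erule eventually_mono, simp)
next
  fix t :: real assume t: "t \<in> {0<..1}"
  have "\<exists>k. \<forall>\<^sub>F s in at_left t. \<lfloor>real n * s\<rfloor> = k"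
  proof (cases "n = 0")
    case False
    let ?b = "(of_int \<lceil>real n * t\<rceil> - 1) / real n"
    have "?b < t" using False by (simp add: pos_divide_less_eq mult.commute) linarith
    moreover have "\<lfloor>real n * s\<rfloor> = \<lceil>real n * t\<rceil> - 1" if "s < t" "?b < s" for s
    proof -
      have "real n * s < real n * t" "of_int \<lceil>real n * t\<rceil> - 1 < real n * s"
        using that False by (simp_all add: pos_divide_less_eq mult.commute)
      then show ?thesis by (intro floor_unique) (simp, linarith)+
    qed
    ultimately show ?thesis unfolding eventually_at_left_field by blast
  qed (intro exI[of _ 0], simp)
  then obtain k where k: "\<forall>\<^sub>F s in at_left t. \<lfloor>real n * s\<rfloor> = k" by blast
  have "((\<lambda>\<tau>. \<phi> (nat \<lfloor>real n * \<tau>\<rfloor>)) \<longlongrightarrow> \<phi> (nat k)) (at_left t)"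
    by (intro tendsto_eventually eventually_mono[OF k]) simp
  then show "\<exists>l. ((\<lambda>\<tau>. \<phi> (nat \<lfloor>real n * \<tau>\<rfloor>)) \<longlongrightarrow> l) (at_left t)" ..
qed

lemma continuous_in_D_space:
  assumes "continuous_on {0..1} f"
  shows "restrict f {0..1} \<in> mspace (D_space 0 1)"
  unfolding D_space_restrict_iff
proof (intro conjI ballI)
  fix t :: real assume t: "t \<in> {0..<1}"
  then have "(f \<longlongrightarrow> f t) (at t within {0..1})" using assms by (auto simp: continuous_on_def)
  moreover have "at_right t \<le> at t within {0..1}"
    using eventually_at_right_unit[OF t]
    by (auto simp: at_within_def le_inf_iff le_principal eventually_inf_principal)
  ultimately show "(f \<longlongrightarrow> f t) (at_right t)" by (rule tendsto_mono[rotated])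
next
  fix t :: real assume t: "t \<in> {0<..1}"
  then have "(f \<longlongrightarrow> f t) (at t within {0..1})" using assms by (auto simp: continuous_on_def)
  moreover have "at_left t \<le> at t within {0..1}"
    using eventually_at_left_unit[OF t]
    by (auto simp: at_within_def le_inf_iff le_principal eventually_inf_principal)
  ultimately have "(f \<longlongrightarrow> f t) (at_left t)" by (rule tendsto_mono[rotated])
  then show "\<exists>l. (f \<longlongrightarrow> l) (at_left t)" ..
qed

lemma D_space_right_continuous:
  assumes "f \<in> mspace (D_space 0 1)" "t \<in> {0..<1}"
  shows "(f \<longlongrightarrow> f t) (at_right t)"
  using assms by (auto simp: mspace_D_space cadlag_on_def continuous_within)

lemma mdist_D_space_le:
  assumes "f \<in> mspace (D_space 0 1)" "g \<in> mspace (D_space 0 1)"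
    and "\<And>t. t \<in> {0..1} \<Longrightarrow> \<bar>f t - g t\<bar> \<le> r"
  shows "mdist (D_space 0 1) f g \<le> r"
  unfolding mdist_D_space[OF zero_le_one assms(1,2)] using assms(3) by (intro cSUP_least) auto

lemma abs_diff_le_mdist_D_space:
  assumes fg: "f \<in> mspace (D_space 0 1)" "g \<in> mspace (D_space 0 1)" and t: "t \<in> {0..1}"
  shows "\<bar>f t - g t\<bar> \<le> mdist (D_space 0 1) f g"
proof -
  have "bounded (f ` {0..1})" "bounded (g ` {0..1})"
    using fg by (auto simp: mspace_D_space intro!: cadlag_on_bounded)
  then obtain a b where "\<forall>x\<in>f ` {0..1}. norm x \<le> a" "\<forall>x\<in>g ` {0..1}. norm x \<le> b"
    unfolding bounded_iff by blast
  then have ab: "\<bar>f t\<bar> \<le> a" "\<bar>g t\<bar> \<le> b" if "t \<in> {0..1}" for t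
    using that by auto
  have "bdd_above ((\<lambda>t. \<bar>f t - g t\<bar>) ` {0..1})"
  proof (rule bdd_aboveI2)
    fix t :: real assume "t \<in> {0..1}"
    then show "\<bar>f t - g t\<bar> \<le> a + b" using ab[of t] by linarith
  qed
  then show ?thesis
    unfolding mdist_D_space[OF zero_le_one fg] using t by (intro cSUP_upper)
qed

text \<open>A violation at \<open>t < 1\<close> persists to the right of \<open>t\<close> by right
  continuity and so meets a rational; the point 1, which has no right neighbourhood, is itself
  rational. This makes distances depend on countably many coordinates.\<close>

lemma mdist_D_space_le_iff_rational:
  assumes fg: "f \<in> mspace (D_space 0 1)" "g \<in> mspace (D_space 0 1)"
  shows "mdist (D_space 0 1) f g \<le> r \<longleftrightarrow> (\<forall>t\<in>\<rat> \<inter> {0..1}. \<bar>f t - g t\<bar> \<le> r)"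
proof
  assume "mdist (D_space 0 1) f g \<le> r"
  then show "\<forall>t\<in>\<rat> \<inter> {0..1}. \<bar>f t - g t\<bar> \<le> r"
    using abs_diff_le_mdist_D_space[OF fg] order_trans by blast
next
  assume rat: "\<forall>t\<in>\<rat> \<inter> {0..1}. \<bar>f t - g t\<bar> \<le> r"
  show "mdist (D_space 0 1) f g \<le> r"
  proof (rule mdist_D_space_le[OF fg], rule ccontr)
    fix t :: real assume t: "t \<in> {0..1}" and gt: "\<not> \<bar>f t - g t\<bar> \<le> r"
    then have "t \<noteq> 1" using rat by auto
    then have t1: "t \<in> {0..<1}" using t by auto
    have "((\<lambda>s. \<bar>f s - g s\<bar>) \<longlongrightarrow> \<bar>f t - g t\<bar>) (at_right t)"
      by (intro tendsto_intros D_space_right_continuous fg t1)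
    then have "\<forall>\<^sub>F s in at_right t. r < \<bar>f s - g s\<bar>"
      using gt by (intro order_tendstoD(1)) auto
    then obtain b where b: "b > t" "\<And>s. t < s \<Longrightarrow> s < b \<Longrightarrow> r < \<bar>f s - g s\<bar>"
      unfolding eventually_at_right_field by blast
    obtain s where "s \<in> \<rat>" "t < s" "s < min b 1"
      using Rats_dense_in_real[of t "min b 1"] b t1 by auto
    then show False using rat b(2)[of s] t1 by force
  qed
qed

lemma measurable_D_spaceI:
  assumes mem: "\<And>\<omega>. \<omega> \<in> space M \<Longrightarrow> Y \<omega> \<in> mspace (D_space 0 1)"
    and meas: "\<And>t. t \<in> {0..1} \<Longrightarrow> (\<lambda>\<omega>. Y \<omega> t) \<in> borel_measurable M"
  shows "Y \<in> M \<rightarrow>\<^sub>M ball_sigma (D_space 0 1)"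
proof (rule measurable_ball_sigmaI[OF mem])
  fix x r assume x: "x \<in> mspace (D_space 0 1)"
  have "(\<lambda>\<omega>. mdist (D_space 0 1) x (Y \<omega>)) \<in> borel_measurable M"
  \<comment> \<open>With the weak inequality the event is a countable intersection of coordinate
    events; a strict bound on a supremum does not split in this way.\<close>
  proof (rule borel_measurableI_le)
    fix a
    have "{\<omega> \<in> space M. mdist (D_space 0 1) x (Y \<omega>) \<le> a} =
        {\<omega> \<in> space M. \<forall>t\<in>\<rat> \<inter> {0..1}. \<bar>x t - Y \<omega> t\<bar> \<le> a}"
      using mdist_D_space_le_iff_rational[OF x mem] by blast
    also have "\<dots> \<in> sets M"
    proof (rule sets.sets_Collect_countable_All')
      show "countable (\<rat> \<inter> {0..1::real})" by (intro countable_Int1 countable_rat)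
      show "{\<omega> \<in> space M. \<bar>x t - Y \<omega> t\<bar> \<le> a} \<in> sets M" if "t \<in> \<rat> \<inter> {0..1}" for t
      proof -
        have [measurable]: "(\<lambda>\<omega>. Y \<omega> t) \<in> borel_measurable M" using that meas by auto
        show ?thesis by measurable
      qed
    qed
    finally show "{\<omega> \<in> space M. mdist (D_space 0 1) x (Y \<omega>) \<le> a} \<in> sets M" .
  qed
  then show "{\<omega> \<in> space M. mdist (D_space 0 1) x (Y \<omega>) < r} \<in> sets M"
    by measurable
qed auto

section \<open>Countable approximation of continuous paths\<close>

definition continuous_paths :: "(real \<Rightarrow> real) set" where
  "continuous_paths = {z \<in> mspace (D_space 0 1). continuous_on {0..1} z}"

text \<open>Indexing by pairs of a natural number and a list of rationals makes countability a
  matter of types. An index beyond the end of the list gives an unspecified rational, which still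
  yields a step function.\<close>

definition rational_steps :: "(real \<Rightarrow> real) set" where
  "rational_steps = range (\<lambda>(n, l). \<lambda>\<tau>\<in>{0..1}. real_of_rat (l ! nat \<lfloor>real n * \<tau>\<rfloor>))"

lemma countable_rational_steps: "countable rational_steps"
  unfolding rational_steps_def by (intro countable_image) auto

lemma rational_steps_subset: "rational_steps \<subseteq> mspace (D_space 0 1)"
  unfolding rational_steps_def
  using floor_step_in_D_space[where \<phi> = "\<lambda>k. real_of_rat (l ! k)" for l] by auto

lemma unit_uniform_modulus:
  fixes z :: "real \<Rightarrow> real"
  assumes z: "continuous_on {0..1} z" and e: "e > 0"
  obtains n0 where "n0 > 0" "\<And>n u v. n \<ge> n0 \<Longrightarrow> u \<in> {0..1} \<Longrightarrow> v \<in> {0..1} \<Longrightarrow>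
    \<bar>u - v\<bar> \<le> 1 / real n \<Longrightarrow> \<bar>z u - z v\<bar> < e"
proof -
  have "uniformly_continuous_on {0..1} z" using z by (intro compact_uniformly_continuous) auto
  then obtain d where d: "d > 0" "\<And>u v. u \<in> {0..1} \<Longrightarrow> v \<in> {0..1} \<Longrightarrow> dist v u < d \<Longrightarrow> dist (z v) (z u) < e"
    using e unfolding uniformly_continuous_on_def by blast
  obtain n0 where n0: "1 / d < real n0" using reals_Archimedean2 by blast
  have n0pos: "n0 > 0" using n0 d(1) by (intro gr0I) (simp add: zero_less_divide_iff not_less)
  show ?thesis
  proof (rule that[OF n0pos])
    fix n u v assume n: "n \<ge> n0" and uv: "u \<in> {0..1}" "v \<in> {0..1}" "\<bar>u - v\<bar> \<le> 1 / real n"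
    have "1 / d < real n" using n n0 by linarith
    then have "1 / real n < d" using d(1) n n0pos by (simp add: field_simps)
    then show "\<bar>z u - z v\<bar> < e"
      using d(2)[of v u] uv by (simp add: dist_real_def)
  qed
qed

lemma floor_grid_error:
  assumes "n > 0" "\<tau> \<in> {0..1}"
  shows "nat \<lfloor>real n * \<tau>\<rfloor> \<le> n" "\<bar>\<tau> - real (nat \<lfloor>real n * \<tau>\<rfloor>) / real n\<bar> \<le> 1 / real n"
proof -
  have le: "real n * \<tau> \<le> real n" "0 \<le> real n * \<tau>"
    using assms by (auto simp: mult_le_cancel_left1)
  then show "nat \<lfloor>real n * \<tau>\<rfloor> \<le> n" by linarith
  have "\<tau> - real (nat \<lfloor>real n * \<tau>\<rfloor>) / real n = (real n * \<tau> - real (nat \<lfloor>real n * \<tau>\<rfloor>)) / real n"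
    using assms by (simp add: diff_divide_distrib)
  moreover have "\<bar>real n * \<tau> - real (nat \<lfloor>real n * \<tau>\<rfloor>)\<bar> \<le> 1"
    using le by linarith
  ultimately show "\<bar>\<tau> - real (nat \<lfloor>real n * \<tau>\<rfloor>) / real n\<bar> \<le> 1 / real n"
    by (simp add: abs_divide divide_right_mono)
qed

lemma rational_steps_dense:
  assumes z: "z \<in> continuous_paths" and e: "e > 0"
  shows "\<exists>q\<in>rational_steps. mdist (D_space 0 1) z q < e"
proof -
  have zD: "z \<in> mspace (D_space 0 1)" and zc: "continuous_on {0..1} z"
    using z by (auto simp: continuous_paths_def)
  obtain n where n: "n > 0" "\<And>n' u v. n' \<ge> n \<Longrightarrow> u \<in> {0..1} \<Longrightarrow> v \<in> {0..1} \<Longrightarrow>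
      \<bar>u - v\<bar> \<le> 1 / real n' \<Longrightarrow> \<bar>z u - z v\<bar> < e / 3"
    using unit_uniform_modulus[OF zc, of "e / 3"] e by auto
  have "\<exists>r. \<bar>real_of_rat r - z (real k / real n)\<bar> < e / 3" for k
  proof -
    obtain x where "x \<in> \<rat>" "z (real k / real n) < x" "x < z (real k / real n) + e / 3"
      using Rats_dense_in_real[of "z (real k / real n)" "z (real k / real n) + e / 3"] e by auto
    moreover then obtain r where "x = real_of_rat r" by (auto elim: Rats_cases)
    ultimately show ?thesis by (intro exI[of _ r]) auto
  qed
  then obtain r where r: "\<And>k. \<bar>real_of_rat (r k) - z (real k / real n)\<bar> < e / 3" by metis
  \<comment> \<open>The list has \<open>Suc n\<close> entries because the index \<open>n\<close>
    occurs at \<tau> = 1.\<close>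
  define q where "q = (\<lambda>\<tau>\<in>{0..1}. real_of_rat (map r [0..<Suc n] ! nat \<lfloor>real n * \<tau>\<rfloor>))"
  have q: "q \<in> rational_steps"
    unfolding rational_steps_def q_def by (rule range_eqI[of _ _ "(n, map r [0..<Suc n])"]) simp
  \<comment> \<open>Two errors of \<open>e / 3\<close>; the rest is slack, since passing to the
    supremum loses the strict inequality.\<close>
  have "mdist (D_space 0 1) z q \<le> 2 * e / 3"
  proof (rule mdist_D_space_le[OF zD])
    show "q \<in> mspace (D_space 0 1)" using q rational_steps_subset by blast
    fix t :: real assume t: "t \<in> {0..1}"
    let ?k = "nat \<lfloor>real n * t\<rfloor>"
    have k: "?k \<le> n" "\<bar>t - real ?k / real n\<bar> \<le> 1 / real n"
      using floor_grid_error[OF n(1) t] by auto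
    then have "\<bar>z t - z (real ?k / real n)\<bar> < e / 3"
      by (intro n(2)[of n] t grid_point) auto
    moreover have "q t = real_of_rat (r ?k)" using t k by (simp add: q_def nth_append del: upt_Suc)
    ultimately show "\<bar>z t - q t\<bar> \<le> 2 * e / 3" using r[of ?k] by linarith
  qed
  then show ?thesis using q e by (intro bexI[of _ q]) auto
qed

lemma eventually_near_path:
  assumes z: "z \<in> mspace (D_space 0 1)" and e: "e > 0"
  shows "\<forall>\<^sub>F p in sequentially \<times>\<^sub>F nhdsin (mtopology_of (D_space 0 1)) z.
    snd p \<in> mspace (D_space 0 1) \<and> (\<forall>t\<in>{0..1}. \<bar>snd p t - z t\<bar> < e)"
proof -
  have "\<forall>\<^sub>F f in nhdsin (mtopology_of (D_space 0 1)) z.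
      f \<in> mspace (D_space 0 1) \<and> (\<forall>t\<in>{0..1}. \<bar>f t - z t\<bar> < e)"
    unfolding eventually_nhdsin_metric[OF z]
  proof (intro exI[of _ e] conjI e ballI impI)
    fix f t assume f: "f \<in> mspace (D_space 0 1)" "mdist (D_space 0 1) z f < e" "t \<in> {0..1::real}"
    then show "\<bar>f t - z t\<bar> < e"
      using abs_diff_le_mdist_D_space[OF f(1) z f(3)] by (simp add: mdist_commute)
  qed
  from eventually_prodI[of "\<lambda>_. True", OF _ this] show ?thesis by simp
qed

lemma grid_close_near_path:
  assumes "z \<in> mspace (D_space 0 1)"
  shows "grid_close (sequentially \<times>\<^sub>F nhdsin (mtopology_of (D_space 0 1)) z) fst
    (\<lambda>p j. snd p (real j / real (fst p))) z"
  unfolding grid_close_def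
proof (intro allI impI)
  fix e :: real assume "e > 0"
  from eventually_near_path[OF assms this]
  show "\<forall>\<^sub>F p in sequentially \<times>\<^sub>F nhdsin (mtopology_of (D_space 0 1)) z.
      \<forall>j\<le>fst p. \<bar>snd p (real j / real (fst p)) - z (real j / real (fst p))\<bar> < e"
    by (rule eventually_mono) (use grid_point in blast)
qed

section \<open>Joint convergence with the backward sums\<close>

definition reversed_path :: "(real \<Rightarrow> real) \<Rightarrow> real \<Rightarrow> real" where
  "reversed_path z = restrict (reversed z) {0..1}"

text \<open>Only grid values of \<open>f\<close> are reflected, so the result is a right continuous
  step function for every \<open>f\<close>. On a centred partial sum path it reproduces the path of
  the backward sums.\<close>

definition reversed_grid :: "nat \<Rightarrow> (real \<Rightarrow> real) \<Rightarrow> real \<Rightarrow> real" where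
  "reversed_grid n f = (\<lambda>\<tau>\<in>{0..1}. f (real n / real n) - f (real (n - nat \<lfloor>real n * \<tau>\<rfloor>) / real n))"

lemma reversed_grid_in_D_space: "reversed_grid n f \<in> mspace (D_space 0 1)"
  unfolding reversed_grid_def
  by (rule floor_step_in_D_space[of "\<lambda>k. f (real n / real n) - f (real (n - k) / real n)" n])

lemma reversed_path_in_D_space:
  "z \<in> continuous_paths \<Longrightarrow> reversed_path z \<in> mspace (D_space 0 1)"
  unfolding reversed_path_def continuous_paths_def
  by (intro continuous_in_D_space reversed_continuous_on) auto

text \<open>Only the limit \<open>z\<close> has to be continuous. One error is closeness at grid
  points, for any \<open>f\<close> near \<open>z\<close>; the other is the modulus of continuity of
  \<open>reversed z\<close> within one cell.\<close>

lemma reversed_grid_tendsto: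
  assumes z: "z \<in> continuous_paths"
  shows "filterlim (\<lambda>p. reversed_grid (fst p) (snd p)) (nhdsin (mtopology_of (D_space 0 1)) (reversed_path z))
    (sequentially \<times>\<^sub>F nhdsin (mtopology_of (D_space 0 1)) z)"
proof -
  let ?F = "sequentially \<times>\<^sub>F nhdsin (mtopology_of (D_space 0 1)) z"
  have zD: "z \<in> mspace (D_space 0 1)" and zc: "continuous_on {0..1} z"
    using z by (auto simp: continuous_paths_def)
  have close: "\<forall>\<^sub>F p in ?F. mdist (D_space 0 1) (reversed_path z) (reversed_grid (fst p) (snd p)) < e"
    if e: "e > 0" for e
  proof -
    obtain n0 where n0: "n0 > 0" "\<And>n u v. n \<ge> n0 \<Longrightarrow> u \<in> {0..1} \<Longrightarrow> v \<in> {0..1} \<Longrightarrow>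
        \<bar>u - v\<bar> \<le> 1 / real n \<Longrightarrow> \<bar>reversed z u - reversed z v\<bar> < e / 3"
      using unit_uniform_modulus[OF reversed_continuous_on[OF zc], of "e / 3"] e by auto
    have "\<forall>\<^sub>F p in ?F. n0 \<le> fst p"
      using filterlim_fst[of sequentially "nhdsin (mtopology_of (D_space 0 1)) z"]
      by (simp add: filterlim_at_top)
    moreover have "\<forall>\<^sub>F p in ?F. \<forall>j\<le>fst p. \<bar>snd p (real (fst p) / real (fst p)) - snd p (real (fst p - j) / real (fst p))
        - reversed z (real j / real (fst p))\<bar> < e / 3"
      using e by (intro grid_closeD[OF grid_close_reversed[OF grid_close_near_path[OF zD] filterlim_fst]]) simp
    ultimately show ?thesis
    proof eventually_elim
      case (elim p)
      have "mdist (D_space 0 1) (reversed_path z) (reversed_grid (fst p) (snd p)) \<le> 2 * e / 3"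
      proof (rule mdist_D_space_le[OF reversed_path_in_D_space[OF z] reversed_grid_in_D_space])
        fix t :: real assume t: "t \<in> {0..1}"
        let ?k = "nat \<lfloor>real (fst p) * t\<rfloor>"
        have n: "fst p > 0" using elim(1) n0 by simp
        have k: "?k \<le> fst p" "\<bar>t - real ?k / real (fst p)\<bar> \<le> 1 / real (fst p)"
          using floor_grid_error[OF n t] by auto
        have "\<bar>reversed z t - reversed z (real ?k / real (fst p))\<bar> < e / 3"
          using k by (intro n0(2)[OF elim(1)] t grid_point)
        moreover have "\<bar>snd p (real (fst p) / real (fst p)) - snd p (real (fst p - ?k) / real (fst p))
            - reversed z (real ?k / real (fst p))\<bar> < e / 3"
          using elim(2) k(1) by blast
        moreover have "reversed_path z t = reversed z t"
          "reversed_grid (fst p) (snd p) t = snd p (real (fst p) / real (fst p)) - snd p (real (fst p - ?k) / real (fst p))"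
          using t by (simp_all add: reversed_path_def reversed_grid_def)
        ultimately show "\<bar>reversed_path z t - reversed_grid (fst p) (snd p) t\<bar> \<le> 2 * e / 3"
          by linarith
      qed
      then show ?case using e by simp
    qed
  qed
  show ?thesis
    unfolding filterlim_iff eventually_nhdsin_metric[OF reversed_path_in_D_space[OF z]]
  proof (intro allI impI)
    fix P assume "\<exists>r>0. \<forall>f\<in>mspace (D_space 0 1). mdist (D_space 0 1) (reversed_path z) f < r \<longrightarrow> P f"
    then obtain r where "r > 0" "\<And>f. f \<in> mspace (D_space 0 1) \<Longrightarrow> mdist (D_space 0 1) (reversed_path z) f < r \<Longrightarrow> P f"
      by blast
    then show "\<forall>\<^sub>F p in ?F. P (reversed_grid (fst p) (snd p))"
      by (intro eventually_mono[OF close[of r]]) (auto intro: reversed_grid_in_D_space)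
  qed
qed

lemma filterlim_nhdsin_max_metric:
  assumes z: "z \<in> mspace m" "z' \<in> mspace m'"
    and f: "filterlim f (nhdsin (mtopology_of m) z) F" and g: "filterlim g (nhdsin (mtopology_of m') z') F"
  shows "filterlim (\<lambda>x. (f x, g x)) (nhdsin (mtopology_of (max_metric m m')) (z, z')) F"
proof -
  have zz: "(z, z') \<in> mspace (max_metric m m')" using z by simp
  show ?thesis
    unfolding filterlim_iff eventually_nhdsin_metric[OF zz]
  proof (intro allI impI)
    fix P assume "\<exists>r>0. \<forall>q\<in>mspace (max_metric m m'). mdist (max_metric m m') (z, z') q < r \<longrightarrow> P q"
    then obtain r where r: "r > 0" "\<And>x y. x \<in> mspace m \<Longrightarrow> y \<in> mspace m' \<Longrightarrow>
        mdist m z x < r \<Longrightarrow> mdist m' z' y < r \<Longrightarrow> P (x, y)"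
      by force
    have "\<forall>\<^sub>F x in F. f x \<in> mspace m \<and> mdist m z (f x) < r"
      using r(1) by (intro filterlim_iff[THEN iffD1, OF f, rule_format])
        (auto simp: eventually_nhdsin_metric[OF z(1)])
    moreover have "\<forall>\<^sub>F x in F. g x \<in> mspace m' \<and> mdist m' z' (g x) < r"
      using r(1) by (intro filterlim_iff[THEN iffD1, OF g, rule_format])
        (auto simp: eventually_nhdsin_metric[OF z(2)])
    ultimately show "\<forall>\<^sub>F x in F. P (f x, g x)"
      by eventually_elim (auto intro: r)
  qed
qed

lemma measurable_Pair_ball_sigma_max:
  assumes f: "f \<in> M \<rightarrow>\<^sub>M ball_sigma m" and g: "g \<in> M \<rightarrow>\<^sub>M ball_sigma m'"
  shows "(\<lambda>\<omega>. (f \<omega>, g \<omega>)) \<in> M \<rightarrow>\<^sub>M ball_sigma (max_metric m m')"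
proof (rule measurable_ball_sigmaI)
  show "(f \<omega>, g \<omega>) \<in> mspace (max_metric m m')" if "\<omega> \<in> space M" for \<omega>
    using measurable_space[OF f that] measurable_space[OF g that] by simp
  fix x r assume "x \<in> mspace (max_metric m m')"
  then have x: "fst x \<in> mspace m" "snd x \<in> mspace m'" by auto
  have [measurable]: "(\<lambda>\<omega>. mdist m (fst x) (f \<omega>)) \<in> borel_measurable M"
    by (rule measurable_compose[OF f borel_measurable_mdist_ball_sigma[OF x(1)]])
  have [measurable]: "(\<lambda>\<omega>. mdist m' (snd x) (g \<omega>)) \<in> borel_measurable M"
    by (rule measurable_compose[OF g borel_measurable_mdist_ball_sigma[OF x(2)]])
  show "{\<omega> \<in> space M. mdist (max_metric m m') x (f \<omega>, g \<omega>) < r} \<in> sets M"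
    by simp
qed

text \<open>A test function \<open>h\<close> on the product is evaluated at
  \<open>(f, reversed_grid n f)\<close> and thus becomes a functional of the forward path alone.
  \<open>expectation_tendsto\<close> asks for measurability of \<open>h\<close> along the random
  pairs only, which follows from measurability of the pairs.\<close>

lemma joint_weak_convergence:
  assumes "separable_weak_limit M N (D_space 0 1) Y Z rational_steps continuous_paths"
    and Y': "\<And>n. Y' n \<in> M \<rightarrow>\<^sub>M ball_sigma (D_space 0 1)"
    and ev: "\<forall>\<^sub>F n in sequentially. \<forall>\<omega>\<in>space M. Y' n \<omega> = reversed_grid n (Y n \<omega>)"
    and V: "AE \<omega> in N. V \<omega> = (Z \<omega>, reversed_path (Z \<omega>))"
  shows "weakly_converges (max_metric (D_space 0 1) (D_space 0 1)) M (\<lambda>n \<omega>. (Y n \<omega>, Y' n \<omega>)) N V"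
proof -
  let ?D = "D_space 0 1"
  interpret separable_weak_limit M N ?D Y Z rational_steps continuous_paths by fact
  obtain \<Omega> where \<Omega>: "\<Omega> \<in> sets N" "\<And>\<omega>. \<omega> \<in> \<Omega> \<Longrightarrow> Z \<omega> \<in> continuous_paths" "AE \<omega> in N. \<omega> \<in> \<Omega>"
    using AE_subset_setsE[OF Z(2)] by blast
  \<comment> \<open>A default path off the good event, so that the limit pair takes values in the
    product space everywhere.\<close>
  define o0 where "o0 = (\<lambda>\<tau>\<in>{0..1::real}. 0::real)"
  have o0: "o0 \<in> mspace ?D" unfolding o0_def by (intro continuous_in_D_space continuous_on_const)
  define Z1 where "Z1 \<omega> = (if \<omega> \<in> \<Omega> then Z \<omega> else o0)" for \<omega>
  define Z2 where "Z2 \<omega> = (if \<omega> \<in> \<Omega> then reversed_path (Z \<omega>) else o0)" for \<omega>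
  have lim: "((\<lambda>(n, f). h (f, reversed_grid n f)) \<longlongrightarrow> h (z, reversed_path z))
      (sequentially \<times>\<^sub>F nhdsin (mtopology_of ?D) z)"
    if h: "continuous_map (mtopology_of (max_metric ?D ?D)) euclidean h" and z: "z \<in> continuous_paths"
    for h :: "_ \<Rightarrow> real" and z
  proof -
    have zD: "z \<in> mspace ?D" using z by (simp add: continuous_paths_def)
    have "(h \<longlongrightarrow> h (z, reversed_path z)) (nhdsin (mtopology_of (max_metric ?D ?D)) (z, reversed_path z))"
      using zD reversed_path_in_D_space[OF z] by (intro continuous_map_tendsto_nhdsin h) simp
    from filterlim_compose[OF this filterlim_nhdsin_max_metric[OF zD reversed_path_in_D_space[OF z]
          filterlim_snd reversed_grid_tendsto[OF z]]]
    show ?thesis by (simp add: case_prod_beta')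
  qed
  have "Z1 \<in> N \<rightarrow>\<^sub>M ball_sigma ?D"
    unfolding Z1_def using \<Omega>(1) o0 by (intro measurable_If_set Z(1)) auto
  moreover have "Z2 \<in> N \<rightarrow>\<^sub>M ball_sigma ?D"
  proof (rule measurable_ball_sigmaI)
    show "Z2 \<omega> \<in> mspace ?D" for \<omega>
      using reversed_path_in_D_space[OF \<Omega>(2)] o0 by (simp add: Z2_def)
    fix g r assume g: "g \<in> mspace ?D"
    \<comment> \<open>The distance from a fixed \<open>g\<close> to the reversed path is a limit
      functional of the distances to \<open>reversed_grid n f\<close>; hence it is continuous along
      \<open>continuous_paths\<close> and has a measurable version.\<close>
    define W where "W \<omega> = (if \<omega> \<in> \<Omega> then mdist ?D g (reversed_path (Z \<omega>)) else 0)" for \<omega>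
    have cg: "continuous_map (mtopology_of ?D) euclidean (mdist ?D g)"
      using g by (intro continuous_map_mdist) auto
    have "((\<lambda>(n, f). mdist ?D g (reversed_grid n f)) \<longlongrightarrow> mdist ?D g (reversed_path z))
        (sequentially \<times>\<^sub>F nhdsin (mtopology_of ?D) z)" if z: "z \<in> continuous_paths" for z
    proof -
      have "(mdist ?D g \<longlongrightarrow> mdist ?D g (reversed_path z)) (nhdsin (mtopology_of ?D) (reversed_path z))"
        using reversed_path_in_D_space[OF z] by (intro continuous_map_tendsto_nhdsin cg) simp
      from filterlim_compose[OF this reversed_grid_tendsto[OF z]]
      show ?thesis by (simp add: case_prod_beta')
    qed
    from measurable_version[OF Q C dense continuous_limit_of_joint_limits[OF C this] Z(1) \<Omega>(1,2)]
    have [measurable]: "W \<in> borel_measurable N" unfolding W_def .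
    have [measurable]: "\<Omega> \<in> sets N" by (rule \<Omega>(1))
    have "{\<omega> \<in> space N. mdist ?D g (Z2 \<omega>) < r} =
        {\<omega> \<in> space N. (\<omega> \<in> \<Omega> \<longrightarrow> W \<omega> < r) \<and> (\<omega> \<notin> \<Omega> \<longrightarrow> mdist ?D g o0 < r)}"
      by (auto simp: Z2_def W_def)
    also have "\<dots> \<in> sets N" by measurable
    finally show "{\<omega> \<in> space N. mdist ?D g (Z2 \<omega>) < r} \<in> sets N" .
  qed
  ultimately have Z12: "(\<lambda>\<omega>. (Z1 \<omega>, Z2 \<omega>)) \<in> N \<rightarrow>\<^sub>M ball_sigma (max_metric ?D ?D)"
    by (rule measurable_Pair_ball_sigma_max)
  have YY: "(\<lambda>\<omega>. (Y n \<omega>, Y' n \<omega>)) \<in> M \<rightarrow>\<^sub>M ball_sigma (max_metric ?D ?D)" for n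
    by (intro measurable_Pair_ball_sigma_max Y Y')
  have eq: "AE \<omega> in N. (Z \<omega>, reversed_path (Z \<omega>)) = (Z1 \<omega>, Z2 \<omega>)"
    using \<Omega>(3) by eventually_elim (simp add: Z1_def Z2_def)
  show ?thesis
    unfolding weakly_converges_def
  proof (intro conjI allI YY exI[of _ "\<lambda>\<omega>. (Z1 \<omega>, Z2 \<omega>)"] Z12 impI)
    show "AE \<omega> in N. V \<omega> = (Z1 \<omega>, Z2 \<omega>)" using V eq by eventually_elim simp
    fix h :: "_ \<Rightarrow> real"
    assume h: "continuous_map (mtopology_of (max_metric ?D ?D)) euclidean h"
      "h \<in> borel_measurable (ball_sigma (max_metric ?D ?D))" "bounded (h ` mspace (max_metric ?D ?D))"
    obtain B where B: "\<forall>x\<in>h ` mspace (max_metric ?D ?D). norm x \<le> B"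
      using h(3) unfolding bounded_iff by blast
    show "(\<lambda>n. \<integral>\<omega>. h (Y n \<omega>, Y' n \<omega>) \<partial>M) \<longlonglongrightarrow> (\<integral>\<omega>. h (Z1 \<omega>, Z2 \<omega>) \<partial>N)"
    proof (rule expectation_tendsto[where Gn = "\<lambda>n f. h (f, reversed_grid n f)"
          and G = "\<lambda>z. h (z, reversed_path z)" and B = B])
      show "(\<lambda>\<omega>. h (Y n \<omega>, Y' n \<omega>)) \<in> borel_measurable M" for n
        by (rule measurable_compose[OF YY h(2)])
      show "(\<lambda>\<omega>. h (Z1 \<omega>, Z2 \<omega>)) \<in> borel_measurable N"
        by (rule measurable_compose[OF Z12 h(2)])
      show "AE \<omega> in N. h (Z \<omega>, reversed_path (Z \<omega>)) = h (Z1 \<omega>, Z2 \<omega>)"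
        using eq by eventually_elim (simp only:)
      show "\<forall>\<^sub>F n in sequentially. \<forall>\<omega>\<in>space M. h (Y n \<omega>, Y' n \<omega>) = h (Y n \<omega>, reversed_grid n (Y n \<omega>))"
        using ev by eventually_elim simp
      show "\<bar>h (f, reversed_grid n f)\<bar> \<le> B" if "f \<in> mspace ?D" for n f
        using B that reversed_grid_in_D_space by simp
      show "\<bar>h (f, reversed_path f)\<bar> \<le> B" if "f \<in> continuous_paths" for f
        using B that C reversed_path_in_D_space[OF that] by auto
    qed (rule lim[OF h(1)])
  qed
qed

section \<open>The statistics as functionals of the path\<close>

lemma V_stat_eq_cs_var: "V_stat x k = cs_var (fwd_sum x) k"
proof (cases "k = 0")
  case False
  have "(real k powr (3/2))\<^sup>2 = real k ^ 3"
    using False by (simp add: powr_powr flip: powr_numeral)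
  then show ?thesis
    by (simp add: V_stat_def cs_var_def power_divide)
qed (simp add: V_stat_def cs_var_def)

text \<open>The substitution \<open>i = n - j + 1\<close> reads the summation from the end of the
  sample; it maps \<open>{k+1..n}\<close> onto \<open>{1..n-k}\<close>.\<close>

lemma V_star_eq_cs_var: "V_star x n k = cs_var (bwd_sum x n) (n - k)"
proof -
  have reindex: "(\<Sum>j=k+1..n. g (n - j + 1)) = (\<Sum>i=1..n-k. g i)" for g :: "nat \<Rightarrow> real"
    by (rule sum.reindex_bij_witness[where i = "\<lambda>i. n - i + 1" and j = "\<lambda>j. n - j + 1"]) auto
  show ?thesis
  proof (cases "n - k = 0")
    case True
    then show ?thesis by (simp add: V_star_def cs_var_def)
  next
    case False
    then have "(real (n - k) powr (3/2))\<^sup>2 = real (n - k) ^ 3"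
      by (simp add: powr_powr flip: powr_numeral)
    then show ?thesis
      unfolding V_star_def cs_var_def
        reindex[of "\<lambda>i. (bwd_sum x n i - real i / real (n - k) * bwd_sum x n (n - k))\<^sup>2"]
        reindex[of "\<lambda>i. bwd_sum x n i - real i / real (n - k) * bwd_sum x n (n - k)"]
      by (simp add: power_divide)
  qed
qed

lemma cs_var_affine:
  assumes "\<And>j. j \<le> k \<Longrightarrow> y j = (s j - real j * a) / g"
  shows "cs_var y k = cs_var s k / g\<^sup>2"
proof (cases "k = 0")
  case False
  have D: "y j - real j / real k * y k = (s j - real j / real k * s k) / g" if "j \<in> {1..k}" for j
    using that False by (simp add: assms diff_divide_distrib right_diff_distrib)
  have "(\<Sum>j=1..k. (y j - real j / real k * y k)\<^sup>2) = (\<Sum>j=1..k. (s j - real j / real k * s k)\<^sup>2) / g\<^sup>2"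
    unfolding sum_divide_distrib by (intro sum.cong refl) (simp only: D power_divide)
  moreover have "(\<Sum>j=1..k. y j - real j / real k * y k) = (\<Sum>j=1..k. s j - real j / real k * s k) / g"
    unfolding sum_divide_distrib by (intro sum.cong refl) (simp only: D)
  ultimately show ?thesis by (simp add: cs_var_def power_divide diff_divide_distrib mult.commute)
qed (simp add: cs_var_def)

lemma fwd_sum_plus_bwd_sum:
  assumes "j \<le> n"
  shows "fwd_sum x (n - j) + bwd_sum x n j = fwd_sum x n"
  unfolding fwd_sum_def bwd_sum_def
  using sum.ub_add_nat[of 1 "n - j" x j] assms by simp

text \<open>With the factor \<open>n\<close> the variances have the limits \<open>Q\<^sub>\<tau>(z)\<close> and \<open>Q\<^bsub>1-\<tau>\<^esub>(z\<^sup>*)\<close>. The argument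
  \<open>real n / real n\<close> is \<open>1\<close> except for the junk value at \<open>n = 0\<close>.\<close>

definition scaled_var :: "nat \<Rightarrow> (real \<Rightarrow> real) \<Rightarrow> real \<Rightarrow> real" where
  "scaled_var n f \<tau> = real n * cs_var (\<lambda>j. f (real j / real n)) (nat \<lfloor>real n * \<tau>\<rfloor>)"

definition scaled_var_rev :: "nat \<Rightarrow> (real \<Rightarrow> real) \<Rightarrow> real \<Rightarrow> real" where
  "scaled_var_rev n f \<tau> = real n *
     cs_var (\<lambda>j. f (real n / real n) - f (real (n - j) / real n)) (n - nat \<lfloor>real n * \<tau>\<rfloor>)"

definition partial_sum_path :: "(nat \<Rightarrow> real) \<Rightarrow> real \<Rightarrow> real \<Rightarrow> nat \<Rightarrow> real \<Rightarrow> real" where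
  "partial_sum_path x a g n = (\<lambda>\<tau>\<in>{0..1}.
     (fwd_sum x (nat \<lfloor>real n * \<tau>\<rfloor>) - real (nat \<lfloor>real n * \<tau>\<rfloor>) * a) / g)"

lemma partial_sum_path_grid:
  assumes "n > 0" "j \<le> n"
  shows "partial_sum_path x a g n (real j / real n) = (fwd_sum x j - real j * a) / g"
  using assms grid_point[OF assms(2)] by (simp add: partial_sum_path_def)

lemma partial_sum_path_reversed_grid:
  assumes "n > 0" "j \<le> n"
  shows "partial_sum_path x a g n (real n / real n) - partial_sum_path x a g n (real (n - j) / real n)
    = (bwd_sum x n j - real j * a) / g"
  unfolding partial_sum_path_grid[OF assms(1) order_refl] partial_sum_path_grid[OF assms(1) diff_le_self]
    fwd_sum_plus_bwd_sum[OF assms(2), symmetric]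
  using assms by (simp add: of_nat_diff left_diff_distrib flip: diff_divide_distrib)

lemma scaled_var_partial_sum_path:
  assumes "n > 0" "\<tau> \<in> {0..1}"
  shows "scaled_var n (partial_sum_path x a g n) \<tau> = real n / g\<^sup>2 * V_stat x (nat \<lfloor>real n * \<tau>\<rfloor>)"
    and "scaled_var_rev n (partial_sum_path x a g n) \<tau> = real n / g\<^sup>2 * V_star x n (nat \<lfloor>real n * \<tau>\<rfloor>)"
proof -
  have k: "nat \<lfloor>real n * \<tau>\<rfloor> \<le> n" by (rule floor_grid_error[OF assms])
  have "cs_var (\<lambda>j. partial_sum_path x a g n (real j / real n)) (nat \<lfloor>real n * \<tau>\<rfloor>)
      = cs_var (fwd_sum x) (nat \<lfloor>real n * \<tau>\<rfloor>) / g\<^sup>2"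
    using k by (intro cs_var_affine[of _ _ _ a] partial_sum_path_grid assms(1)) simp
  then show "scaled_var n (partial_sum_path x a g n) \<tau> = real n / g\<^sup>2 * V_stat x (nat \<lfloor>real n * \<tau>\<rfloor>)"
    by (simp add: scaled_var_def V_stat_eq_cs_var)
  have "cs_var (\<lambda>j. partial_sum_path x a g n (real n / real n) - partial_sum_path x a g n (real (n - j) / real n))
        (n - nat \<lfloor>real n * \<tau>\<rfloor>)
      = cs_var (bwd_sum x n) (n - nat \<lfloor>real n * \<tau>\<rfloor>) / g\<^sup>2"
    using k by (intro cs_var_affine[of _ _ _ a] partial_sum_path_reversed_grid assms(1)) simp
  then show "scaled_var_rev n (partial_sum_path x a g n) \<tau> = real n / g\<^sup>2 * V_star x n (nat \<lfloor>real n * \<tau>\<rfloor>)"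
    by (simp add: scaled_var_rev_def V_star_eq_cs_var)
qed

text \<open>A finite range turns the infimum into a minimum, which commutes with monotone
  maps.\<close>

lemma cINF_mult_left_real:
  fixes f :: "'a \<Rightarrow> real"
  assumes A: "A \<noteq> {}" and f: "finite (f ` A)" and c: "c > 0"
  shows "(INF x\<in>A. c * f x) = c * (INF x\<in>A. f x)"
proof -
  have "mono ((*) c)" using c by (auto simp: mono_def)
  then have "c * Min (f ` A) = Min ((*) c ` f ` A)"
    using f A by (intro mono_Min_commute) auto
  moreover have "finite ((*) c ` f ` A)" using f by simp
  ultimately have "c * Inf (f ` A) = Inf ((*) c ` f ` A)"
    using f A by (simp add: cInf_eq_Min)
  then show ?thesis by (simp add: image_image)
qed

lemma finite_floor_image:
  fixes \<phi> :: "nat \<Rightarrow> real"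
  assumes "T \<subseteq> {0..1}"
  shows "finite ((\<lambda>\<tau>. \<phi> (nat \<lfloor>real n * \<tau>\<rfloor>)) ` T)"
proof -
  have "nat \<lfloor>real n * \<tau>\<rfloor> \<le> n" if "\<tau> \<in> T" for \<tau>
    using floor_grid_error(1)[of n \<tau>] that assms by (cases "n = 0") auto
  then have "(\<lambda>\<tau>. \<phi> (nat \<lfloor>real n * \<tau>\<rfloor>)) ` T \<subseteq> \<phi> ` {..n}" by auto
  then show ?thesis by (rule finite_subset) simp
qed

text \<open>In the ratio \<open>L_stat\<close> the factor \<open>n / g\<^sup>2\<close> cancels for
  each \<tau>, also where the denominator is 0 and both quotients are 0. In \<open>R_stat\<close> it
  first has to be pulled out of the two infima, where its positivity matters.\<close>

lemma statistics_partial_sum_path: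
  fixes x :: "nat \<Rightarrow> real" and a :: real
  assumes "n > 0" "g > 0" "T \<subseteq> {0..1}" "T \<noteq> {}"
  defines "f \<equiv> partial_sum_path x a g n"
  shows "W_stat T x n = (SUP \<tau>\<in>T. scaled_var_rev n f \<tau> / scaled_var n f \<tau>)"
    and "I_stat T x n = integral T (\<lambda>\<tau>. scaled_var_rev n f \<tau> / scaled_var n f \<tau>)"
    and "R_stat T x n = (INF \<tau>\<in>T. scaled_var_rev n f \<tau>) / (INF \<tau>\<in>T. scaled_var n f \<tau>)"
proof -
  have c: "real n / g\<^sup>2 > 0" using assms by simp
  have v: "scaled_var n f \<tau> = real n / g\<^sup>2 * V_stat x (nat \<lfloor>real n * \<tau>\<rfloor>)"
    "scaled_var_rev n f \<tau> = real n / g\<^sup>2 * V_star x n (nat \<lfloor>real n * \<tau>\<rfloor>)" if "\<tau> \<in> T" for \<tau>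
    unfolding f_def by (rule scaled_var_partial_sum_path; use that assms(1,3) in blast)+
  then have L: "L_stat x n \<tau> = scaled_var_rev n f \<tau> / scaled_var n f \<tau>" if "\<tau> \<in> T" for \<tau>
    using that assms(1,2) by (simp add: L_stat_def)
  show "W_stat T x n = (SUP \<tau>\<in>T. scaled_var_rev n f \<tau> / scaled_var n f \<tau>)"
    unfolding W_stat_def by (intro SUP_cong refl L)
  show "I_stat T x n = integral T (\<lambda>\<tau>. scaled_var_rev n f \<tau> / scaled_var n f \<tau>)"
    unfolding I_stat_def by (intro integral_cong L)
  note scale = cINF_mult_left_real[OF assms(4) finite_floor_image[OF assms(3)] c]
  have "(INF \<tau>\<in>T. scaled_var n f \<tau>) = real n / g\<^sup>2 * (INF \<tau>\<in>T. V_stat x (nat \<lfloor>real n * \<tau>\<rfloor>))"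
    unfolding scale[symmetric] by (intro INF_cong refl v(1))
  moreover have "(INF \<tau>\<in>T. scaled_var_rev n f \<tau>) = real n / g\<^sup>2 * (INF \<tau>\<in>T. V_star x n (nat \<lfloor>real n * \<tau>\<rfloor>))"
    unfolding scale[symmetric] by (intro INF_cong refl v(2))
  ultimately show "R_stat T x n = (INF \<tau>\<in>T. scaled_var_rev n f \<tau>) / (INF \<tau>\<in>T. scaled_var n f \<tau>)"
    using assms(1,2) by (simp add: R_stat_def)
qed

text \<open>The integrand is a finite combination of indicators of level sets. The weights do not
  involve \<phi>, so an integral over random steps is a finite linear combination of random
  variables; this also gives integrability of the ratios before the limit.\<close>

lemma floor_step_integral:
  fixes \<phi> :: "nat \<Rightarrow> real"
  assumes "{lo..hi} \<subseteq> {0..1}"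
  shows "((\<lambda>\<tau>. \<phi> (nat \<lfloor>real n * \<tau>\<rfloor>)) has_integral
    (\<Sum>k\<le>n. \<phi> k * integral {lo..hi} (indicator {\<tau>. nat \<lfloor>real n * \<tau>\<rfloor> = k}))) {lo..hi}"
proof -
  have ind: "(indicator {\<tau>. nat \<lfloor>real n * \<tau>\<rfloor> = k} :: real \<Rightarrow> real) integrable_on {lo..hi}" for k
  proof -
    have "{\<tau> \<in> space borel. nat \<lfloor>real n * \<tau>\<rfloor> = k} \<in> sets (borel :: real measure)" by measurable
    then have "{\<tau>. nat \<lfloor>real n * \<tau>\<rfloor> = k} \<inter> {lo..hi} \<in> sets lborel"
      by (simp add: sets.Int)
    then have "{\<tau>. nat \<lfloor>real n * \<tau>\<rfloor> = k} \<inter> {lo..hi} \<in> lmeasurable"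
      by (intro bounded_set_imp_lmeasurable bounded_Int) auto
    then show ?thesis by (simp add: integrable_on_indicator)
  qed
  have "((\<lambda>\<tau>. \<Sum>k\<le>n. \<phi> k * indicator {\<tau>. nat \<lfloor>real n * \<tau>\<rfloor> = k} \<tau>) has_integral
    (\<Sum>k\<le>n. \<phi> k * integral {lo..hi} (indicator {\<tau>. nat \<lfloor>real n * \<tau>\<rfloor> = k}))) {lo..hi}"
    by (intro has_integral_sum has_integral_mult_right integrable_integral ind) auto
  moreover have "(\<Sum>k\<le>n. \<phi> k * indicator {\<tau>. nat \<lfloor>real n * \<tau>\<rfloor> = k} \<tau>) = \<phi> (nat \<lfloor>real n * \<tau>\<rfloor>)"
    if "\<tau> \<in> {lo..hi}" for \<tau>
  proof -
    have "nat \<lfloor>real n * \<tau>\<rfloor> \<le> n"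
      using floor_grid_error(1)[of n \<tau>] that assms by (cases "n = 0") auto
    then show ?thesis by (simp add: indicator_def of_bool_def if_distrib sum.delta cong: if_cong)
  qed
  ultimately show ?thesis by (rule has_integral_eq[rotated]) 
qed

section \<open>Measurability of the statistics\<close>

lemma borel_measurable_cs_var:
  assumes "\<And>j. (\<lambda>\<omega>. y j \<omega>) \<in> borel_measurable M"
  shows "(\<lambda>\<omega>. cs_var (\<lambda>j. y j \<omega>) k) \<in> borel_measurable M"
proof -
  note assms[measurable]
  show ?thesis unfolding cs_var_def by measurable
qed

context
  fixes M :: "'p measure" and X :: "nat \<Rightarrow> 'p \<Rightarrow> real"
  assumes X: "\<And>j. 1 \<le> j \<Longrightarrow> X j \<in> borel_measurable M"
begin

lemma borel_measurable_sums:
  shows "(\<lambda>\<omega>. fwd_sum (\<lambda>j. X j \<omega>) k) \<in> borel_measurable M"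
    and "(\<lambda>\<omega>. bwd_sum (\<lambda>j. X j \<omega>) n k) \<in> borel_measurable M"
  unfolding fwd_sum_def bwd_sum_def by (auto intro!: borel_measurable_sum X)

lemma borel_measurable_V:
  shows "(\<lambda>\<omega>. V_stat (\<lambda>j. X j \<omega>) k) \<in> borel_measurable M"
    and "(\<lambda>\<omega>. V_star (\<lambda>j. X j \<omega>) n k) \<in> borel_measurable M"
  unfolding V_stat_eq_cs_var V_star_eq_cs_var
  by (intro borel_measurable_cs_var borel_measurable_sums)+

text \<open>Although \<open>T\<close> may be uncountable, only indices up to \<open>n\<close> occur,
  so the extrema are those of finitely many random variables.\<close>

lemma borel_measurable_floor_SUP:
  fixes \<phi> :: "nat \<Rightarrow> 'p \<Rightarrow> real"
  assumes "\<And>k. \<phi> k \<in> borel_measurable M" "T \<subseteq> {0..1}" "T \<noteq> {}"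
  shows "(\<lambda>\<omega>. SUP \<tau>\<in>T. \<phi> (nat \<lfloor>real n * \<tau>\<rfloor>) \<omega>) \<in> borel_measurable M"
    and "(\<lambda>\<omega>. INF \<tau>\<in>T. \<phi> (nat \<lfloor>real n * \<tau>\<rfloor>) \<omega>) \<in> borel_measurable M"
proof -
  define K where "K = (\<lambda>\<tau>. nat \<lfloor>real n * \<tau>\<rfloor>) ` T"
  have "K \<subseteq> {..n}"
    unfolding K_def using floor_grid_error(1)[of n] assms(2) by (cases "n = 0") auto
  then have K: "finite K" "K \<noteq> {}" using assms(3) by (auto simp: K_def finite_subset)
  have "(SUP \<tau>\<in>T. \<phi> (nat \<lfloor>real n * \<tau>\<rfloor>) \<omega>) = Max ((\<lambda>k. \<phi> k \<omega>) ` K)" for \<omega>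
  proof -
    have "(SUP \<tau>\<in>T. \<phi> (nat \<lfloor>real n * \<tau>\<rfloor>) \<omega>) = Sup ((\<lambda>k. \<phi> k \<omega>) ` K)"
      by (simp add: K_def image_image)
    then show ?thesis using K by (simp add: cSup_eq_Max)
  qed
  moreover have "(INF \<tau>\<in>T. \<phi> (nat \<lfloor>real n * \<tau>\<rfloor>) \<omega>) = Min ((\<lambda>k. \<phi> k \<omega>) ` K)" for \<omega>
  proof -
    have "(INF \<tau>\<in>T. \<phi> (nat \<lfloor>real n * \<tau>\<rfloor>) \<omega>) = Inf ((\<lambda>k. \<phi> k \<omega>) ` K)"
      by (simp add: K_def image_image)
    then show ?thesis using K by (simp add: cInf_eq_Min)
  qed
  ultimately show "(\<lambda>\<omega>. SUP \<tau>\<in>T. \<phi> (nat \<lfloor>real n * \<tau>\<rfloor>) \<omega>) \<in> borel_measurable M"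
    and "(\<lambda>\<omega>. INF \<tau>\<in>T. \<phi> (nat \<lfloor>real n * \<tau>\<rfloor>) \<omega>) \<in> borel_measurable M"
    using K assms(1) by (auto intro!: borel_measurable_Max borel_measurable_Min)
qed

lemma borel_measurable_statistics:
  assumes T: "{lo..hi} \<subseteq> {0..1}" "lo \<le> hi"
  shows "(\<lambda>\<omega>. W_stat {lo..hi} (\<lambda>j. X j \<omega>) n) \<in> borel_measurable M"
    and "(\<lambda>\<omega>. I_stat {lo..hi} (\<lambda>j. X j \<omega>) n) \<in> borel_measurable M"
    and "(\<lambda>\<omega>. R_stat {lo..hi} (\<lambda>j. X j \<omega>) n) \<in> borel_measurable M"
proof -
  define r where "r k \<omega> = V_star (\<lambda>j. X j \<omega>) n k / V_stat (\<lambda>j. X j \<omega>) k" for k \<omega>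
  have [measurable]: "r k \<in> borel_measurable M" for k
    unfolding r_def by (intro borel_measurable_divide borel_measurable_V)
  have L: "L_stat (\<lambda>j. X j \<omega>) n \<tau> = r (nat \<lfloor>real n * \<tau>\<rfloor>) \<omega>" for \<tau> \<omega>
    by (simp add: L_stat_def r_def)
  show "(\<lambda>\<omega>. W_stat {lo..hi} (\<lambda>j. X j \<omega>) n) \<in> borel_measurable M"
    unfolding W_stat_def L using T by (intro borel_measurable_floor_SUP) auto
  have "I_stat {lo..hi} (\<lambda>j. X j \<omega>) n =
      (\<Sum>k\<le>n. r k \<omega> * integral {lo..hi} (indicator {\<tau>. nat \<lfloor>real n * \<tau>\<rfloor> = k}))" for \<omega>
    unfolding I_stat_def L by (rule integral_unique[OF floor_step_integral[OF T(1)]])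
  then show "(\<lambda>\<omega>. I_stat {lo..hi} (\<lambda>j. X j \<omega>) n) \<in> borel_measurable M"
    by simp
  show "(\<lambda>\<omega>. R_stat {lo..hi} (\<lambda>j. X j \<omega>) n) \<in> borel_measurable M"
    unfolding R_stat_def using T
    by (intro borel_measurable_divide borel_measurable_floor_SUP(2) borel_measurable_V) auto
qed

end

section \<open>Limits of the statistics along converging paths\<close>

lemma statistics_limits:
  assumes z: "z \<in> continuous_paths" "Q_fun lo z > 0" and lohi: "0 < lo" "lo \<le> hi" "hi < 1"
  defines "F \<equiv> sequentially \<times>\<^sub>F nhdsin (mtopology_of (D_space 0 1)) z"
  shows "((\<lambda>(n, f). SUP \<tau>\<in>{lo..hi}. scaled_var_rev n f \<tau> / scaled_var n f \<tau>) \<longlongrightarrow>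
      (SUP \<tau>\<in>{lo..hi}. Q_fun (1 - \<tau>) (reversed z) / Q_fun \<tau> z)) F"
    and "((\<lambda>(n, f). integral {lo..hi} (\<lambda>\<tau>. scaled_var_rev n f \<tau> / scaled_var n f \<tau>)) \<longlongrightarrow>
      integral {lo..hi} (\<lambda>\<tau>. Q_fun (1 - \<tau>) (reversed z) / Q_fun \<tau> z)) F"
    and "((\<lambda>(n, f). (INF \<tau>\<in>{lo..hi}. scaled_var_rev n f \<tau>) / (INF \<tau>\<in>{lo..hi}. scaled_var n f \<tau>)) \<longlongrightarrow>
      (INF \<tau>\<in>{lo..hi}. Q_fun (1 - \<tau>) (reversed z)) / (INF \<tau>\<in>{lo..hi}. Q_fun \<tau> z)) F"
proof -
  have zD: "z \<in> mspace (D_space 0 1)" and zc: "continuous_on {0..1} z"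
    using z by (auto simp: continuous_paths_def)
  have F: "F \<noteq> bot" unfolding F_def by (simp add: prod_filter_eq_bot nhdsin_metric_neq_bot[OF zD])
  have N: "filterlim fst at_top F" unfolding F_def by (rule filterlim_fst)
  have pos: "Q_fun \<tau> z > 0" if "\<tau> \<in> {lo..hi}" for \<tau>
    using that lohi by (intro Q_fun_pos_mono[OF zc lohi(1) _ _ z(2)]) auto
  have T: "{lo..hi} \<noteq> {}" "compact {lo..hi}" "{lo..hi} \<subseteq> {0..1}" using lohi by auto
  note lims = cs_var_uniform_limit[OF grid_close_near_path[OF zD, folded F_def] zc F N lohi(1,3),
      folded scaled_var_def scaled_var_rev_def]
  have ratio: "uniform_limit {lo..hi} (\<lambda>p \<tau>. scaled_var_rev (fst p) (snd p) \<tau> / scaled_var (fst p) (snd p) \<tau>)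
      (\<lambda>\<tau>. Q_fun (1 - \<tau>) (reversed z) / Q_fun \<tau> z) F"
    using pos by (intro lims(5)) force
  have cratio: "continuous_on {lo..hi} (\<lambda>\<tau>. Q_fun (1 - \<tau>) (reversed z) / Q_fun \<tau> z)"
    using pos by (intro continuous_on_divide lims(2,4)) force
  have bdd: "bounded (l ` {lo..hi})" if "continuous_on {lo..hi} l" for l :: "real \<Rightarrow> real"
    by (intro compact_imp_bounded compact_continuous_image that T(2))
  show "((\<lambda>(n, f). SUP \<tau>\<in>{lo..hi}. scaled_var_rev n f \<tau> / scaled_var n f \<tau>) \<longlongrightarrow>
      (SUP \<tau>\<in>{lo..hi}. Q_fun (1 - \<tau>) (reversed z) / Q_fun \<tau> z)) F"
    using uniform_limit_SUP[OF ratio T(1) bdd[OF cratio]] by (simp add: case_prod_beta')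
  have "((\<lambda>p. integral {lo..hi} (\<lambda>\<tau>. scaled_var_rev (fst p) (snd p) \<tau> / scaled_var (fst p) (snd p) \<tau>)) \<longlongrightarrow>
      integral {lo..hi} (\<lambda>\<tau>. Q_fun (1 - \<tau>) (reversed z) / Q_fun \<tau> z)) F"
  proof (rule uniform_limit_integral_tendsto[OF ratio lohi(2) always_eventually])
    show "\<forall>p. (\<lambda>\<tau>. scaled_var_rev (fst p) (snd p) \<tau> / scaled_var (fst p) (snd p) \<tau>) integrable_on {lo..hi}"
      unfolding scaled_var_def scaled_var_rev_def
      using floor_step_integral[OF T(3), of "\<lambda>k. real n * cs_var (\<lambda>j. f (real n / real n) - f (real (n - j) / real n)) (n - k)
          / (real n * cs_var (\<lambda>j. f (real j / real n)) k)" n for n f]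
      by (blast intro: has_integral_integrable)
    show "(\<lambda>\<tau>. Q_fun (1 - \<tau>) (reversed z) / Q_fun \<tau> z) integrable_on {lo..hi}"
      by (rule integrable_continuous_interval[OF cratio])
  qed
  then show "((\<lambda>(n, f). integral {lo..hi} (\<lambda>\<tau>. scaled_var_rev n f \<tau> / scaled_var n f \<tau>)) \<longlongrightarrow>
      integral {lo..hi} (\<lambda>\<tau>. Q_fun (1 - \<tau>) (reversed z) / Q_fun \<tau> z)) F"
    by (simp add: case_prod_beta')
  \<comment> \<open>Pointwise positivity would allow an infimum equal to 0; a minimizer, which
    exists by continuity and compactness, excludes this.\<close>
  obtain t where t: "t \<in> {lo..hi}" "\<And>\<tau>. \<tau> \<in> {lo..hi} \<Longrightarrow> Q_fun t z \<le> Q_fun \<tau> z"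
    using continuous_attains_inf[OF T(2,1) lims(2)] by blast
  have "Q_fun t z \<le> (INF \<tau>\<in>{lo..hi}. Q_fun \<tau> z)" using T(1) t by (intro cINF_greatest) auto
  then have "(INF \<tau>\<in>{lo..hi}. Q_fun \<tau> z) \<noteq> 0" using pos[OF t(1)] by simp
  then have "((\<lambda>p. (INF \<tau>\<in>{lo..hi}. scaled_var_rev (fst p) (snd p) \<tau>) / (INF \<tau>\<in>{lo..hi}. scaled_var (fst p) (snd p) \<tau>)) \<longlongrightarrow>
      (INF \<tau>\<in>{lo..hi}. Q_fun (1 - \<tau>) (reversed z)) / (INF \<tau>\<in>{lo..hi}. Q_fun \<tau> z)) F"
    by (intro tendsto_divide uniform_limit_INF lims T(1) bdd)
  then show "((\<lambda>(n, f). (INF \<tau>\<in>{lo..hi}. scaled_var_rev n f \<tau>) / (INF \<tau>\<in>{lo..hi}. scaled_var n f \<tau>)) \<longlongrightarrow>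
      (INF \<tau>\<in>{lo..hi}. Q_fun (1 - \<tau>) (reversed z)) / (INF \<tau>\<in>{lo..hi}. Q_fun \<tau> z)) F"
    by (simp add: case_prod_beta')
qed

lemma Q_fun_cong:
  assumes "\<And>u. u \<in> {0..1} \<Longrightarrow> z u = z' u" "\<tau> \<in> {0..1}"
  shows "Q_fun \<tau> z = Q_fun \<tau> z'"
proof -
  have "integral {0..\<tau>} (\<lambda>u. (z u - u / \<tau> * z \<tau>)\<^sup>2) = integral {0..\<tau>} (\<lambda>u. (z' u - u / \<tau> * z' \<tau>)\<^sup>2)"
    "integral {0..\<tau>} (\<lambda>u. z u - u / \<tau> * z \<tau>) = integral {0..\<tau>} (\<lambda>u. z' u - u / \<tau> * z' \<tau>)"
    using assms by (auto intro!: integral_cong)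
  then show ?thesis by (simp add: Q_fun_def)
qed

theorem proposition3p1:
  fixes M :: "'p measure" and N :: "'q measure"
    and X :: "nat \<Rightarrow> 'p \<Rightarrow> real" and Z :: "'q \<Rightarrow> real \<Rightarrow> real"
    and \<gamma> A :: "nat \<Rightarrow> real"
  assumes "prob_space M" and "prob_space N"
    and "\<And>j. 1 \<le> j \<Longrightarrow> X j \<in> borel_measurable M"
    and "filterlim \<gamma> at_top sequentially"
    and "weakly_converges (D_space 0 1)
           M (\<lambda>n \<omega>. \<lambda>\<tau>\<in>{0..1}.
                (fwd_sum (\<lambda>j. X j \<omega>) (nat \<lfloor>real n * \<tau>\<rfloor>) - real (nat \<lfloor>real n * \<tau>\<rfloor>) * A n) / \<gamma> n)
           N (\<lambda>\<omega>. \<lambda>\<tau>\<in>{0..1}. Z \<omega> \<tau>)"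
    and "nondegenerate 0 1 N Z"
    and "AE \<omega> in N. continuous_on {0..1} (Z \<omega>)"
  shows "weakly_converges (max_metric (D_space 0 1) (D_space 0 1))
           M (\<lambda>n \<omega>.
               (\<lambda>\<tau>\<in>{0..1}.
                  (fwd_sum (\<lambda>j. X j \<omega>) (nat \<lfloor>real n * \<tau>\<rfloor>) - real (nat \<lfloor>real n * \<tau>\<rfloor>) * A n) / \<gamma> n,
                \<lambda>\<tau>\<in>{0..1}.
                  (bwd_sum (\<lambda>j. X j \<omega>) n (nat \<lfloor>real n * \<tau>\<rfloor>) - real (nat \<lfloor>real n * \<tau>\<rfloor>) * A n) / \<gamma> n))
           N (\<lambda>\<omega>. (\<lambda>\<tau>\<in>{0..1}. Z \<omega> \<tau>, \<lambda>\<tau>\<in>{0..1}. reversed (Z \<omega>) \<tau>))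
    \<and> (\<forall>lo hi. 0 < lo \<and> lo \<le> hi \<and> hi < 1 \<and> (\<forall>\<tau>\<in>{lo..hi}. AE \<omega> in N. Q_fun \<tau> (Z \<omega>) > 0) \<longrightarrow>
         converges_in_law M (\<lambda>n \<omega>. W_stat {lo..hi} (\<lambda>j. X j \<omega>) n)
           N (\<lambda>\<omega>. SUP \<tau>\<in>{lo..hi}. Q_fun (1 - \<tau>) (reversed (Z \<omega>)) / Q_fun \<tau> (Z \<omega>))
       \<and> converges_in_law M (\<lambda>n \<omega>. I_stat {lo..hi} (\<lambda>j. X j \<omega>) n)
           N (\<lambda>\<omega>. integral {lo..hi} (\<lambda>\<tau>. Q_fun (1 - \<tau>) (reversed (Z \<omega>)) / Q_fun \<tau> (Z \<omega>)))
       \<and> converges_in_law M (\<lambda>n \<omega>. R_stat {lo..hi} (\<lambda>j. X j \<omega>) n)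
           N (\<lambda>\<omega>. (INF \<tau>\<in>{lo..hi}. Q_fun (1 - \<tau>) (reversed (Z \<omega>)))
                    / (INF \<tau>\<in>{lo..hi}. Q_fun \<tau> (Z \<omega>))))"
proof (intro conjI allI impI)
  let ?D = "D_space 0 1"
  note X = assms(3)
  define Y where "Y n \<omega> = partial_sum_path (\<lambda>j. X j \<omega>) (A n) (\<gamma> n) n" for n \<omega>
  define Y' where "Y' n \<omega> = (\<lambda>\<tau>\<in>{0..1}.
      (bwd_sum (\<lambda>j. X j \<omega>) n (nat \<lfloor>real n * \<tau>\<rfloor>) - real (nat \<lfloor>real n * \<tau>\<rfloor>) * A n) / \<gamma> n)" for n \<omega>
  \<comment> \<open>\<open>Z'\<close> is a random element with values in D everywhere; the arguments
    run on it and return to \<open>Z\<close> through almost sure equality.\<close>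
  from assms(5) obtain Z' where Ymeas: "\<And>n. Y n \<in> M \<rightarrow>\<^sub>M ball_sigma ?D"
    and Z'meas: "Z' \<in> N \<rightarrow>\<^sub>M ball_sigma ?D"
    and Z'eq: "AE \<omega> in N. (\<lambda>\<tau>\<in>{0..1}. Z \<omega> \<tau>) = Z' \<omega>"
    and weak: "\<And>h :: _ \<Rightarrow> real. continuous_map (mtopology_of ?D) euclidean h \<Longrightarrow>
        h \<in> borel_measurable (ball_sigma ?D) \<Longrightarrow> bounded (h ` mspace ?D) \<Longrightarrow>
        (\<lambda>n. \<integral>\<omega>. h (Y n \<omega>) \<partial>M) \<longlonglongrightarrow> (\<integral>\<omega>. h (Z' \<omega>) \<partial>N)"
    unfolding weakly_converges_def Y_def[abs_def] partial_sum_path_def[abs_def] by blast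
  have Z'cont: "AE \<omega> in N. Z' \<omega> \<in> continuous_paths"
    using Z'eq assms(7)
  proof eventually_elim
    case (elim \<omega>)
    have "continuous_on {0..1} (Z' \<omega>)"
      unfolding elim(1)[symmetric] using elim(2) by (rule continuous_on_eq) simp
    moreover have "Z' \<omega> \<in> mspace ?D"
      unfolding elim(1)[symmetric] by (rule continuous_in_D_space[OF elim(2)])
    ultimately show ?case by (simp add: continuous_paths_def)
  qed
  have limit: "separable_weak_limit M N ?D Y Z' rational_steps C"
    if "C \<subseteq> continuous_paths" "AE \<omega> in N. Z' \<omega> \<in> C" for C
  proof -
    interpret M: prob_space M by fact
    interpret N: prob_space N by fact
    show ?thesis
      by unfold_locales
        (use that countable_rational_steps rational_steps_subset rational_steps_dense Ymeas Z'meas weak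
          in \<open>auto simp: continuous_paths_def\<close>)
  qed
  show "weakly_converges (max_metric ?D ?D)
           M (\<lambda>n \<omega>.
               (\<lambda>\<tau>\<in>{0..1}.
                  (fwd_sum (\<lambda>j. X j \<omega>) (nat \<lfloor>real n * \<tau>\<rfloor>) - real (nat \<lfloor>real n * \<tau>\<rfloor>) * A n) / \<gamma> n,
                \<lambda>\<tau>\<in>{0..1}.
                  (bwd_sum (\<lambda>j. X j \<omega>) n (nat \<lfloor>real n * \<tau>\<rfloor>) - real (nat \<lfloor>real n * \<tau>\<rfloor>) * A n) / \<gamma> n))
           N (\<lambda>\<omega>. (\<lambda>\<tau>\<in>{0..1}. Z \<omega> \<tau>, \<lambda>\<tau>\<in>{0..1}. reversed (Z \<omega>) \<tau>))"
    unfolding partial_sum_path_def[symmetric] Y_def[symmetric] Y'_def[symmetric]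
  proof (rule joint_weak_convergence[OF limit[OF order_refl Z'cont]])
    show "Y' n \<in> M \<rightarrow>\<^sub>M ball_sigma ?D" for n
    proof (rule measurable_D_spaceI)
      show "Y' n \<omega> \<in> mspace ?D" for \<omega>
        unfolding Y'_def
        by (rule floor_step_in_D_space[of "\<lambda>k. (bwd_sum (\<lambda>j. X j \<omega>) n k - real k * A n) / \<gamma> n"])
      show "(\<lambda>\<omega>. Y' n \<omega> t) \<in> borel_measurable M" if "t \<in> {0..1}" for t
        using that borel_measurable_sums(2)[OF X] by (simp add: Y'_def)
    qed
    show "\<forall>\<^sub>F n in sequentially. \<forall>\<omega>\<in>space M. Y' n \<omega> = reversed_grid n (Y n \<omega>)"
      using eventually_gt_at_top[of 0]
    proof eventually_elim
      case (elim n)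
      have "Y' n \<omega> = reversed_grid n (Y n \<omega>)" for \<omega>
        unfolding Y'_def reversed_grid_def Y_def
        by (intro restrict_ext partial_sum_path_reversed_grid[symmetric] elim floor_grid_error(1))
      then show ?case by blast
    qed
    show "AE \<omega> in N. (\<lambda>\<tau>\<in>{0..1}. Z \<omega> \<tau>, \<lambda>\<tau>\<in>{0..1}. reversed (Z \<omega>) \<tau>) = (Z' \<omega>, reversed_path (Z' \<omega>))"
      using Z'eq
    proof eventually_elim
      case (elim \<omega>)
      have "(\<lambda>\<tau>\<in>{0..1}. reversed (Z \<omega>) \<tau>) = reversed_path (Z' \<omega>)"
        unfolding reversed_path_def elim[symmetric] by (intro restrict_ext) (simp add: reversed_def)
      then show ?case using elim by simp
    qed
  qed
  fix lo hi :: real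
  assume "0 < lo \<and> lo \<le> hi \<and> hi < 1 \<and> (\<forall>\<tau>\<in>{lo..hi}. AE \<omega> in N. Q_fun \<tau> (Z \<omega>) > 0)"
  then have lohi: "0 < lo" "lo \<le> hi" "hi < 1" and pos: "AE \<omega> in N. Q_fun lo (Z \<omega>) > 0"
    by auto
  have T: "{lo..hi} \<subseteq> {0..1}" "{lo..hi} \<noteq> {}" using lohi by auto
  \<comment> \<open>One null set serves every \<tau>, since all these quantities depend only on the
    path on the unit interval.\<close>
  have Qeq: "AE \<omega> in N. \<forall>\<tau>\<in>{lo..hi}. Q_fun \<tau> (Z \<omega>) = Q_fun \<tau> (Z' \<omega>) \<and>
      Q_fun (1 - \<tau>) (reversed (Z \<omega>)) = Q_fun (1 - \<tau>) (reversed (Z' \<omega>))"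
    using Z'eq
  proof eventually_elim
    case (elim \<omega>)
    have "Z \<omega> u = Z' \<omega> u" if "u \<in> {0..1}" for u
      unfolding elim[symmetric] using that by simp
    then show ?case
      using T by (intro ballI conjI Q_fun_cong) (auto simp: reversed_def subset_iff)
  qed
  \<comment> \<open>On this set every denominator \<open>Q_fun \<tau> z\<close> with \<tau> in the
    interval is positive, so the limits of all three statistics exist.\<close>
  define C where "C = {z \<in> continuous_paths. Q_fun lo z > 0}"
  have "AE \<omega> in N. Z' \<omega> \<in> C"
    using Z'cont pos Qeq by eventually_elim (use lohi in \<open>auto simp: C_def\<close>)
  then interpret separable_weak_limit M N ?D Y Z' rational_steps C
    by (intro limit) (auto simp: C_def)
  \<comment> \<open>The identities are stated for the tail only, where \<open>n > 0\<close> and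
    \<open>\<gamma> n > 0\<close>; the divergence of \<gamma> provides the second condition.\<close>
  have stats: "\<forall>\<^sub>F n in sequentially. \<forall>\<omega>\<in>space M.
      W_stat {lo..hi} (\<lambda>j. X j \<omega>) n =
        (SUP \<tau>\<in>{lo..hi}. scaled_var_rev n (Y n \<omega>) \<tau> / scaled_var n (Y n \<omega>) \<tau>) \<and>
      I_stat {lo..hi} (\<lambda>j. X j \<omega>) n =
        integral {lo..hi} (\<lambda>\<tau>. scaled_var_rev n (Y n \<omega>) \<tau> / scaled_var n (Y n \<omega>) \<tau>) \<and>
      R_stat {lo..hi} (\<lambda>j. X j \<omega>) n =
        (INF \<tau>\<in>{lo..hi}. scaled_var_rev n (Y n \<omega>) \<tau>) / (INF \<tau>\<in>{lo..hi}. scaled_var n (Y n \<omega>) \<tau>)"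
    using eventually_gt_at_top[of 0] filterlim_at_top_dense[THEN iffD1, OF assms(4), rule_format, of 0]
  proof eventually_elim
    case (elim n)
    then show ?case
      unfolding Y_def using statistics_partial_sum_path[OF elim T] by blast
  qed
  show "converges_in_law M (\<lambda>n \<omega>. W_stat {lo..hi} (\<lambda>j. X j \<omega>) n)
      N (\<lambda>\<omega>. SUP \<tau>\<in>{lo..hi}. Q_fun (1 - \<tau>) (reversed (Z \<omega>)) / Q_fun \<tau> (Z \<omega>))"
  proof (rule converges_in_law_functional[OF statistics_limits(1)[OF _ _ lohi]])
    show "\<forall>\<^sub>F n in sequentially. \<forall>\<omega>\<in>space M. W_stat {lo..hi} (\<lambda>j. X j \<omega>) n =
        (SUP \<tau>\<in>{lo..hi}. scaled_var_rev n (Y n \<omega>) \<tau> / scaled_var n (Y n \<omega>) \<tau>)"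
      using stats by eventually_elim blast
    show "AE \<omega> in N. (SUP \<tau>\<in>{lo..hi}. Q_fun (1 - \<tau>) (reversed (Z \<omega>)) / Q_fun \<tau> (Z \<omega>)) =
        (SUP \<tau>\<in>{lo..hi}. Q_fun (1 - \<tau>) (reversed (Z' \<omega>)) / Q_fun \<tau> (Z' \<omega>))"
      using Qeq by eventually_elim (auto intro!: SUP_cong)
  qed (auto simp: C_def intro!: borel_measurable_statistics X T lohi)
  show "converges_in_law M (\<lambda>n \<omega>. I_stat {lo..hi} (\<lambda>j. X j \<omega>) n)
      N (\<lambda>\<omega>. integral {lo..hi} (\<lambda>\<tau>. Q_fun (1 - \<tau>) (reversed (Z \<omega>)) / Q_fun \<tau> (Z \<omega>)))"
  proof (rule converges_in_law_functional[OF statistics_limits(2)[OF _ _ lohi]])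
    show "\<forall>\<^sub>F n in sequentially. \<forall>\<omega>\<in>space M. I_stat {lo..hi} (\<lambda>j. X j \<omega>) n =
        integral {lo..hi} (\<lambda>\<tau>. scaled_var_rev n (Y n \<omega>) \<tau> / scaled_var n (Y n \<omega>) \<tau>)"
      using stats by eventually_elim blast
    show "AE \<omega> in N. integral {lo..hi} (\<lambda>\<tau>. Q_fun (1 - \<tau>) (reversed (Z \<omega>)) / Q_fun \<tau> (Z \<omega>)) =
        integral {lo..hi} (\<lambda>\<tau>. Q_fun (1 - \<tau>) (reversed (Z' \<omega>)) / Q_fun \<tau> (Z' \<omega>))"
      using Qeq by eventually_elim (auto intro!: integral_cong)
  qed (auto simp: C_def intro!: borel_measurable_statistics X T lohi)
  show "converges_in_law M (\<lambda>n \<omega>. R_stat {lo..hi} (\<lambda>j. X j \<omega>) n)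
      N (\<lambda>\<omega>. (INF \<tau>\<in>{lo..hi}. Q_fun (1 - \<tau>) (reversed (Z \<omega>))) / (INF \<tau>\<in>{lo..hi}. Q_fun \<tau> (Z \<omega>)))"
  proof (rule converges_in_law_functional[OF statistics_limits(3)[OF _ _ lohi]])
    show "\<forall>\<^sub>F n in sequentially. \<forall>\<omega>\<in>space M. R_stat {lo..hi} (\<lambda>j. X j \<omega>) n =
        (INF \<tau>\<in>{lo..hi}. scaled_var_rev n (Y n \<omega>) \<tau>) / (INF \<tau>\<in>{lo..hi}. scaled_var n (Y n \<omega>) \<tau>)"
      using stats by eventually_elim blast
    show "AE \<omega> in N. (INF \<tau>\<in>{lo..hi}. Q_fun (1 - \<tau>) (reversed (Z \<omega>))) / (INF \<tau>\<in>{lo..hi}. Q_fun \<tau> (Z \<omega>)) =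
        (INF \<tau>\<in>{lo..hi}. Q_fun (1 - \<tau>) (reversed (Z' \<omega>))) / (INF \<tau>\<in>{lo..hi}. Q_fun \<tau> (Z' \<omega>))"
      using Qeq by eventually_elim (auto intro!: arg_cong2[where f = "(/)"] INF_cong)
  qed (auto simp: C_def intro!: borel_measurable_statistics X T lohi)
qed

end
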